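(* Consider the $d$-dimensional Gaussian Volterra principal-agent model described in the context, and let $\Gamma$ be symmetric positive-definite. The optimal level of effort that maximizes the linear principal's problem $$V_{lin}(y)=\sup_{b\in\mathbb{R}}\mathbb{E}^{*}\big[U_P(X_T-Y_T^{y,b})\big]$$ is given by $\Gamma^{-1}\beta^*$ with $$\beta^*_t=b^*K(T,t),\quad t\le T,\qquad b^*=\frac{\langle K_T,(\gamma_PI_d+\Gamma^{-1})K_T\rangle_{L^2}}{\langle K_T,((\gamma_A+\gamma_P)I_d+\Gamma^{-1})K_T\rangle_{L^2}}.$$ The utility of the principal at time $0$, $V_{lin}=\sup_{y\ge y_0}V_{lin}(y)$, is given by $V_{lin}=V_{lin}(y_0)$ with $$V_{lin}(y)=-\exp\big(-\gamma_P(g_0(T)-y)+\chi_0\big),\qquad \chi_0=\frac{\gamma_P}{2}\Big\langle K_T,\big(\gamma_PI_d-b^*(\gamma_PI_d+\Gamma^{-1})\big)K_T\Big\rangle_{L^2}.$$ The optimal linear contract $\xi^*$ that maximizes the linear principal's problem is given by $$\xi^*=y_0-b^*g_0(T)+\int_0^Tf^*(\beta^*_s)\,ds+b^*X_T .$$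
   Context: Setting. Let $T>0$, and let $(\Omega,\mathcal{F},\mathbb{F}=(\mathcal{F}_t)_{t\le T},\mathbb{P}_0)$ be a filtered probability space carrying a $d$-dimensional standard $\mathbb{F}$-Brownian motion $B$. $\langle\cdot,\cdot\rangle$ and $\|\cdot\|$ are the canonical inner product and norm of $\mathbb{R}^d$. Let $g_0:[0,T]\to\mathbb{R}$ be a measurable deterministic function and $K:[0,T]^2\to\mathbb{R}^d$ a measurable Volterra kernel, i.e. $K(t,s)=0$ for $s\ge t$, with $\sup_{t\le T}\int_0^T\|K(t,s)\|^2ds<\infty$. Write $K_T(s)=K(T,s)$ and $\langle f,g\rangle_{L^2}=\int_0^T\langle f(s),g(s)\rangle ds$. The (real-valued) aggregate output is $X_t=g_0(t)+\int_0^t\langle K(t,s),dB_s\rangle$. An effort of the agent is an $\mathbb{F}$-progressively measurable $\mathbb{R}^d$-valued process $a$ with $\int_0^T\|a_s\|^2ds$ $\mathbb{P}_0$-a.s. bounded by a constant; it induces the probability measure $\mathbb{P}_a$ with $\frac{d\mathbb{P}_a}{d\mathbb{P}_0}=\exp\big(\int_0^T\langle a_s,dB_s\rangle-\frac12\int_0^T\|a_s\|^2ds\big)$. Preferences: the principal and the agent are risk averse with CARA utilities $U_P(x)=-e^{-\gamma_Px}$ and $U_A(x)=-e^{-\gamma_Ax}$ ($\gamma_P,\gamma_A>0$); the agent's reservation utility is $U_A(y_0)$. The agent's instantaneous effort cost is $\frac12\langle a,\Gamma a\rangle$. Linear contracts: with $f^*(z)=\frac12\langle z,(\gamma_AI_d-\Gamma^{-1})z\rangle$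 for $z\in\mathbb{R}^d$, for $y\ge y_0$ and $b\in\mathbb{R}$ the linear contract is $$Y_T^{y,b}=y+\int_0^Tf^*(bK(T,s))ds+b\int_0^T\langle K(T,s),dB_s\rangle=y+\int_0^Tf^*(bK(T,s))ds+b\,(X_T-g_0(T)).$$ The agent's best reply to $Y_T^{y,b}$ is the deterministic effort $a_t=\Gamma^{-1}\beta_t$ with $\beta_t=bK(T,t)$, and $\mathbb{E}^*$ denotes expectation under $\mathbb{P}_a$ for this $a$. *)

theory Defs
  imports "HOL-Probability.Probability"
begin

definition filtration_on :: "'a measure \<Rightarrow> real \<Rightarrow> (real \<Rightarrow> 'a measure) \<Rightarrow> bool" where
  "filtration_on M T F \<longleftrightarrow>
     (\<forall>t\<in>{0..T}. subalgebra M (F t)) \<and>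
     (\<forall>s t. 0 \<le> s \<longrightarrow> s \<le> t \<longrightarrow> t \<le> T \<longrightarrow> sets (F s) \<subseteq> sets (F t))"

text \<open>Increments over \<open>[s,t]\<close> have law \<open>N(0, (t - s) I)\<close> (product density) and are independent
  of \<open>F s\<close>.\<close>

definition brownian_motion ::
    "'a measure \<Rightarrow> real \<Rightarrow> (real \<Rightarrow> 'a measure) \<Rightarrow> (real \<Rightarrow> 'a \<Rightarrow> real ^ 'n) \<Rightarrow> bool" where
  "brownian_motion M T F B \<longleftrightarrow>
     (\<forall>t\<in>{0..T}. B t \<in> borel_measurable (F t)) \<and>
     (AE \<omega> in M. B 0 \<omega> = 0) \<and>
     (AE \<omega> in M. continuous_on {0..T} (\<lambda>t. B t \<omega>)) \<and>
     (\<forall>s t. 0 \<le> s \<longrightarrow> s < t \<longrightarrow> t \<le> T \<longrightarrow>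
        distributed M lborel (\<lambda>\<omega>. B t \<omega> - B s \<omega>)
          (\<lambda>x. ennreal (\<Prod>i\<in>UNIV. normal_density 0 (sqrt (t - s)) (x $ i))) \<and>
        prob_space.indep_set M (sets (F s))
          (sets (vimage_algebra (space M) (\<lambda>\<omega>. B t \<omega> - B s \<omega>) borel)))"

definition step_fun ::
    "nat \<Rightarrow> (nat \<Rightarrow> real) \<Rightarrow> (nat \<Rightarrow> real ^ 'n) \<Rightarrow> real \<Rightarrow> real ^ 'n" where
  "step_fun n p c s = (\<Sum>k<n. indicat_real {p k<..p (Suc k)} s *\<^sub>R c k)"

definition step_integral ::
    "(real \<Rightarrow> 'a \<Rightarrow> real ^ 'n) \<Rightarrow> nat \<Rightarrow> (nat \<Rightarrow> real) \<Rightarrow> (nat \<Rightarrow> real ^ 'n) \<Rightarrow> 'a \<Rightarrow> real" where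
  "step_integral B n p c \<omega> = (\<Sum>k<n. c k \<bullet> (B (p (Suc k)) \<omega> - B (p k) \<omega>))"

text \<open>\<open>I\<close> is (a version of) the integral of \<open>f\<close> against \<open>B\<close> over \<open>[0,t]\<close>: the \<open>L\<^sup>2\<close>-limit of the
  integrals of step functions converging to \<open>f\<close> in \<open>L\<^sup>2([0,t])\<close>. For square-integrable \<open>f\<close>
  such an \<open>I\<close> exists and is almost surely unique; \<open>wiener_integral\<close> selects one version.\<close>

definition is_wiener_integral ::
    "'a measure \<Rightarrow> (real \<Rightarrow> 'a \<Rightarrow> real ^ 'n) \<Rightarrow> real \<Rightarrow> (real \<Rightarrow> real ^ 'n) \<Rightarrow> ('a \<Rightarrow> real) \<Rightarrow> bool" where
  "is_wiener_integral M B t f I \<longleftrightarrow>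
     set_borel_measurable lborel {0..t} f \<and> I \<in> borel_measurable M \<and>
     (\<exists>n p c.
        (\<forall>m. 0 \<le> p m 0 \<and> (\<forall>k<n m. p m k \<le> p m (Suc k)) \<and> p m (n m) \<le> t) \<and>
        (\<lambda>m. \<integral>\<^sup>+s\<in>{0..t}. ennreal ((norm (f s - step_fun (n m) (p m) (c m) s))\<^sup>2) \<partial>lborel)
          \<longlonglongrightarrow> 0 \<and>
        (\<lambda>m. \<integral>\<^sup>+\<omega>. ennreal ((I \<omega> - step_integral B (n m) (p m) (c m) \<omega>)\<^sup>2) \<partial>M) \<longlonglongrightarrow> 0)"

definition wiener_integral ::
    "'a measure \<Rightarrow> (real \<Rightarrow> 'a \<Rightarrow> real ^ 'n) \<Rightarrow> real \<Rightarrow> (real \<Rightarrow> real ^ 'n) \<Rightarrow> 'a \<Rightarrow> real" where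
  "wiener_integral M B t f = (SOME I. is_wiener_integral M B t f I)"

definition volterra_kernel :: "real \<Rightarrow> (real \<Rightarrow> real \<Rightarrow> real ^ 'n) \<Rightarrow> bool" where
  "volterra_kernel T K \<longleftrightarrow>
     (\<lambda>(t, s). K t s) \<in> borel_measurable (restrict_space borel ({0..T} \<times> {0..T})) \<and>
     (\<forall>t\<in>{0..T}. \<forall>s\<in>{0..T}. t \<le> s \<longrightarrow> K t s = 0) \<and>
     (SUP t\<in>{0..T}. \<integral>\<^sup>+s\<in>{0..T}. ennreal ((norm (K t s))\<^sup>2) \<partial>lborel) < \<infinity>"

definition L2_inner :: "real \<Rightarrow> (real \<Rightarrow> real ^ 'n) \<Rightarrow> (real \<Rightarrow> real ^ 'n) \<Rightarrow> real" where
  "L2_inner T f g = (LINT s:{0..T}|lborel. f s \<bullet> g s)"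

definition sym_pos_def :: "real ^ 'n ^ 'n \<Rightarrow> bool" where
  "sym_pos_def A \<longleftrightarrow> transpose A = A \<and> (\<forall>x. x \<noteq> 0 \<longrightarrow> 0 < x \<bullet> (A *v x))"

definition cara :: "real \<Rightarrow> real \<Rightarrow> real" where
  "cara \<gamma> x = - exp (- \<gamma> * x)"

definition agg_output ::
    "'a measure \<Rightarrow> (real \<Rightarrow> 'a \<Rightarrow> real ^ 'n) \<Rightarrow> (real \<Rightarrow> real) \<Rightarrow> (real \<Rightarrow> real \<Rightarrow> real ^ 'n) \<Rightarrow>
     real \<Rightarrow> 'a \<Rightarrow> real" where
  "agg_output M B g\<^sub>0 K t \<omega> = g\<^sub>0 t + wiener_integral M B t (K t) \<omega>"

text \<open>Girsanov change of measure induced by a deterministic effort \<open>a\<close>, so that its stochastic integral is a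
  Wiener integral.\<close>

definition effort_measure ::
    "'a measure \<Rightarrow> (real \<Rightarrow> 'a \<Rightarrow> real ^ 'n) \<Rightarrow> real \<Rightarrow> (real \<Rightarrow> real ^ 'n) \<Rightarrow> 'a measure" where
  "effort_measure M B T a =
     density M (\<lambda>\<omega>. ennreal (exp (wiener_integral M B T a \<omega>
                                  - 1/2 * (LINT s:{0..T}|lborel. (norm (a s))\<^sup>2))))"

definition f_star :: "real \<Rightarrow> real ^ 'n ^ 'n \<Rightarrow> real ^ 'n \<Rightarrow> real" where
  "f_star \<gamma>\<^sub>A \<Gamma> z = 1/2 * (z \<bullet> ((\<gamma>\<^sub>A *\<^sub>R mat 1 - matrix_inv \<Gamma>) *v z))"

definition linear_contract ::
    "'a measure \<Rightarrow> (real \<Rightarrow> 'a \<Rightarrow> real ^ 'n) \<Rightarrow> real \<Rightarrow> (real \<Rightarrow> real \<Rightarrow> real ^ 'n) \<Rightarrow>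
     real ^ 'n ^ 'n \<Rightarrow> real \<Rightarrow> real \<Rightarrow> real \<Rightarrow> 'a \<Rightarrow> real" where
  "linear_contract M B T K \<Gamma> \<gamma>\<^sub>A y b \<omega> =
     y + (LINT s:{0..T}|lborel. f_star \<gamma>\<^sub>A \<Gamma> (b *\<^sub>R K T s)) + b * wiener_integral M B T (K T) \<omega>"

text \<open>The agent's optimal (deterministic) effort against the contract with slope \<open>b\<close>, i.e. the
  maximiser of expected CARA utility of the contract net of the cost \<open>1/2 \<langle>a, \<Gamma> a\<rangle>\<close>. It does not depend
  on \<open>y\<close>. The principal's expectation \<open>E*\<close> is taken under the measure this effort induces.\<close>

definition best_reply ::
    "real \<Rightarrow> (real \<Rightarrow> real \<Rightarrow> real ^ 'n) \<Rightarrow> real ^ 'n ^ 'n \<Rightarrow> real \<Rightarrow> real \<Rightarrow> real ^ 'n" where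
  "best_reply T K \<Gamma> b t = matrix_inv \<Gamma> *v (b *\<^sub>R K T t)"

definition reply_measure ::
    "'a measure \<Rightarrow> (real \<Rightarrow> 'a \<Rightarrow> real ^ 'n) \<Rightarrow> real \<Rightarrow> (real \<Rightarrow> real \<Rightarrow> real ^ 'n) \<Rightarrow>
     real ^ 'n ^ 'n \<Rightarrow> real \<Rightarrow> 'a measure" where
  "reply_measure M B T K \<Gamma> b = effort_measure M B T (best_reply T K \<Gamma> b)"

definition principal_payoff ::
    "'a measure \<Rightarrow> (real \<Rightarrow> 'a \<Rightarrow> real ^ 'n) \<Rightarrow> real \<Rightarrow> (real \<Rightarrow> real) \<Rightarrow>
     (real \<Rightarrow> real \<Rightarrow> real ^ 'n) \<Rightarrow> real ^ 'n ^ 'n \<Rightarrow> real \<Rightarrow> real \<Rightarrow> real \<Rightarrow> real \<Rightarrow> 'a \<Rightarrow> real" where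
  "principal_payoff M B T g\<^sub>0 K \<Gamma> \<gamma>\<^sub>A \<gamma>\<^sub>P y b \<omega> =
     cara \<gamma>\<^sub>P (agg_output M B g\<^sub>0 K T \<omega> - linear_contract M B T K \<Gamma> \<gamma>\<^sub>A y b \<omega>)"

definition principal_value ::
    "'a measure \<Rightarrow> (real \<Rightarrow> 'a \<Rightarrow> real ^ 'n) \<Rightarrow> real \<Rightarrow> (real \<Rightarrow> real) \<Rightarrow>
     (real \<Rightarrow> real \<Rightarrow> real ^ 'n) \<Rightarrow> real ^ 'n ^ 'n \<Rightarrow> real \<Rightarrow> real \<Rightarrow> real \<Rightarrow> real \<Rightarrow> real" where
  "principal_value M B T g\<^sub>0 K \<Gamma> \<gamma>\<^sub>A \<gamma>\<^sub>P y b =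
     integral\<^sup>L (reply_measure M B T K \<Gamma> b) (principal_payoff M B T g\<^sub>0 K \<Gamma> \<gamma>\<^sub>A \<gamma>\<^sub>P y b)"

definition V_lin ::
    "'a measure \<Rightarrow> (real \<Rightarrow> 'a \<Rightarrow> real ^ 'n) \<Rightarrow> real \<Rightarrow> (real \<Rightarrow> real) \<Rightarrow>
     (real \<Rightarrow> real \<Rightarrow> real ^ 'n) \<Rightarrow> real ^ 'n ^ 'n \<Rightarrow> real \<Rightarrow> real \<Rightarrow> real \<Rightarrow> real" where
  "V_lin M B T g\<^sub>0 K \<Gamma> \<gamma>\<^sub>A \<gamma>\<^sub>P y = (SUP b. principal_value M B T g\<^sub>0 K \<Gamma> \<gamma>\<^sub>A \<gamma>\<^sub>P y b)"

end

theory Submission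
  imports Defs
begin

text \<open>Against the contract of slope \<open>b\<close> the exponent of the principal's payoff, together with the logarithm
  of the Girsanov density, is a constant plus the Wiener integral of
  \<open>b \<Gamma>\<^sup>-\<^sup>1 K\<^sub>T - \<gamma>\<^sub>P (1 - b) K\<^sub>T\<close>. A Wiener integral of \<open>f\<close> is centred Gaussian, so that the expectation of
  its exponential is \<open>exp (\<parallel>f\<parallel>\<^sup>2 / 2)\<close>; only this moment is needed. For step functions it follows from
  the independence of the increments, and it passes to \<open>L\<^sup>2\<close>-limits. With \<open>\<kappa> = \<langle>K\<^sub>T, K\<^sub>T\<rangle>\<close> and
  \<open>G = \<langle>K\<^sub>T, \<Gamma>\<^sup>-\<^sup>1 K\<^sub>T\<rangle>\<close> the principal's value becomes minus the exponential of a quadratic in \<open>b\<close> with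
  leading coefficient \<open>\<gamma>\<^sub>P ((\<gamma>\<^sub>A + \<gamma>\<^sub>P) \<kappa> + G) / 2\<close> and vertex \<open>b*\<close>. If \<open>\<kappa> = 0\<close> the kernel is null, every
  slope is optimal (then \<open>b* = 0/0 = 0\<close>), and all efforts and all contracts coincide almost everywhere.\<close>

subsection \<open>Gaussian increments\<close>

text \<open>\<open>wiener_integral\<close> selects a version by \<open>SOME\<close>, which has two
  consequences. Existence must be proved before the selected function says anything; this takes the
  density of step functions in L^2 and a completeness argument. And nothing relates the versions
  selected for two integrands to the one selected for a combination of them. The work is therefore
  done on the relation \<open>wiener\<close>, which is closed under sums and multiples, and the
  exponential moment is shown for every version. The Girsanov integral and the integral of
  \<open>K T\<close> can then be added freely, and versions are compared only for a null integrand.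
  Exponential moments do double duty: the second-moment bound that makes step integrals Cauchy is
  read off from them too, so that independence of increments enters through a single induction. The
  Girsanov normalisation and the exponential moment each contribute half the squared norm of the
  effort, with opposite signs. This cancellation is why only \<kappa> and G are left in the
  quadratic.\<close>

lemma nn_integral_normal_density_exp:
  assumes "\<sigma> > 0"
  shows "(\<integral>\<^sup>+x. ennreal (normal_density 0 \<sigma> x * exp (c * x)) \<partial>lborel) = ennreal (exp (\<sigma>\<^sup>2 * c\<^sup>2 / 2))"
proof -
  \<comment> \<open>Completing the square: the factor \<open>exp (c * x)\<close> moves the mean from
    0 to \<open>\<sigma>\<^sup>2 * c\<close> and leaves a constant behind.\<close>
  have *: "normal_density 0 \<sigma> x * exp (c * x) = exp (\<sigma>\<^sup>2 * c\<^sup>2 / 2) * normal_density (\<sigma>\<^sup>2 * c) \<sigma> x" for x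
  proof -
    have "- x\<^sup>2 / (2 * \<sigma>\<^sup>2) + c * x = \<sigma>\<^sup>2 * c\<^sup>2 / 2 + - (x - \<sigma>\<^sup>2 * c)\<^sup>2 / (2 * \<sigma>\<^sup>2)"
      using assms by (simp add: field_simps power2_eq_square)
    then show ?thesis
      by (simp add: normal_density_def flip: exp_add)
  qed
  have "(\<integral>\<^sup>+x. ennreal (normal_density 0 \<sigma> x * exp (c * x)) \<partial>lborel)
      = ennreal (exp (\<sigma>\<^sup>2 * c\<^sup>2 / 2)) * (\<integral>\<^sup>+x. ennreal (normal_density (\<sigma>\<^sup>2 * c) \<sigma> x) \<partial>lborel)"
    by (simp add: * ennreal_mult nn_integral_cmult)
  also have "(\<integral>\<^sup>+x. ennreal (normal_density (\<sigma>\<^sup>2 * c) \<sigma> x) \<partial>lborel) = 1"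
    using assms by (subst nn_integral_eq_integral) auto
  finally show ?thesis by simp
qed

text \<open>The integrand factors over the coordinates, so Tonelli reduces it to dimension one. The
  Brownian density is a product over components, whereas the product rule for \<open>lborel\<close>
  runs over \<open>Basis\<close>; \<open>basis\<close> translates between the two.\<close>

lemma nn_integral_normal_prod_exp:
  fixes c :: "real ^ 'n"
  assumes "\<sigma> > 0"
  shows "(\<integral>\<^sup>+x. ennreal (\<Prod>i\<in>UNIV. normal_density 0 \<sigma> (x $ i)) * ennreal (exp (c \<bullet> x)) \<partial>lborel)
       = ennreal (exp (\<sigma>\<^sup>2 * (norm c)\<^sup>2 / 2))"
proof -
  have basis: "(\<Prod>b\<in>Basis. h b) = (\<Prod>i\<in>UNIV. h (axis i 1))" for h :: "real ^ 'n \<Rightarrow> ennreal"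
  proof -
    let ?e = "\<lambda>i::'n. axis i (1::real)"
    have "(Basis :: (real ^ 'n) set) = range ?e"
      by (auto simp: Basis_vec_def)
    moreover have "inj ?e"
      by (auto simp: inj_def axis_eq_axis)
    ultimately show ?thesis
      using prod.reindex[of ?e UNIV h] by (simp add: o_def)
  qed
  have "(\<integral>\<^sup>+x. ennreal (\<Prod>i\<in>UNIV. normal_density 0 \<sigma> (x $ i)) * ennreal (exp (c \<bullet> x)) \<partial>lborel)
      = (\<integral>\<^sup>+x. (\<Prod>b\<in>Basis. ennreal (normal_density 0 \<sigma> (x \<bullet> b) * exp ((c \<bullet> b) * (x \<bullet> b)))) \<partial>lborel)"
  proof (intro nn_integral_cong)
    fix x :: "real ^ 'n"
    have "c \<bullet> x = (\<Sum>i\<in>UNIV. c $ i * x $ i)"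
      by (simp add: inner_vec_def)
    then show "ennreal (\<Prod>i\<in>UNIV. normal_density 0 \<sigma> (x $ i)) * ennreal (exp (c \<bullet> x))
        = (\<Prod>b\<in>Basis. ennreal (normal_density 0 \<sigma> (x \<bullet> b) * exp ((c \<bullet> b) * (x \<bullet> b))))"
      by (simp add: basis inner_axis exp_sum prod_nonneg prod_ennreal prod.distrib flip: ennreal_mult)
  qed
  also have "\<dots> = (\<Prod>b\<in>Basis. ennreal (exp (\<sigma>\<^sup>2 * (c \<bullet> b)\<^sup>2 / 2)))"
    using assms
    by (subst nn_integral_lborel_prod) (auto simp: nn_integral_normal_density_exp)
  also have "\<dots> = ennreal (exp (\<Sum>b\<in>Basis. \<sigma>\<^sup>2 * (c \<bullet> b)\<^sup>2 / 2))"
    by (simp add: prod_ennreal exp_sum)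
  also have "(\<Sum>b\<in>Basis. \<sigma>\<^sup>2 * (c \<bullet> b)\<^sup>2 / 2) = \<sigma>\<^sup>2 * (norm c)\<^sup>2 / 2"
    unfolding power2_norm_eq_inner euclidean_inner[of c c] sum_distrib_left sum_divide_distrib
    by (simp add: power2_eq_square)
  finally show ?thesis .
qed

text \<open>As a simp rule it rewrites a sum of indicators times vectors into a sum over a filtered
  index set, which would destroy the shape of step functions.\<close>

declare sum_indicator_scaleR [simp del]

subsection \<open>Step functions and their integrals\<close>

text \<open>A relation between integrand and integral: both come from the same partition, so it
  never has to be shown that the integral is independent of the partition chosen.\<close>

definition step_pair ::
    "real \<Rightarrow> (real \<Rightarrow> 'a \<Rightarrow> real ^ 'n) \<Rightarrow> (real \<Rightarrow> real ^ 'n) \<Rightarrow> ('a \<Rightarrow> real) \<Rightarrow> bool" where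
  "step_pair T B f X \<longleftrightarrow>
     (\<exists>n p c. 0 \<le> p 0 \<and> (\<forall>k<n. p k \<le> p (Suc k)) \<and> p n \<le> T \<and>
        f = step_fun n p c \<and> X = step_integral B n p c)"

text \<open>The times in \<open>S\<close> belong to no partition, so that a sum of two jump representations is again one;
  passing through them spares the common refinement of two partitions.\<close>

definition jump_pair ::
    "real \<Rightarrow> (real \<Rightarrow> 'a \<Rightarrow> real ^ 'n) \<Rightarrow> real set \<Rightarrow> (real \<Rightarrow> real ^ 'n) \<Rightarrow>
     (real \<Rightarrow> real ^ 'n) \<Rightarrow> ('a \<Rightarrow> real) \<Rightarrow> bool" where
  "jump_pair T B S c f X \<longleftrightarrow> finite S \<and> S \<subseteq> {0<..T} \<and>
     f = (\<lambda>s. \<Sum>t\<in>S. indicat_real {0<..t} s *\<^sub>R c t) \<and>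
     X = (\<lambda>\<omega>. \<Sum>t\<in>S. c t \<bullet> (B t \<omega> - B 0 \<omega>))"

section \<open>Partitions versus jump representations, and sums of step functions\<close>

lemma step_pair_mono_point:
  assumes "\<forall>k<n. p k \<le> p (Suc k)" and "j \<le> i" and "i \<le> n"
  shows "p j \<le> (p i :: real)"
  using assms(2,3)
proof (induction i rule: dec_induct)
  case (step i)
  then show ?case using assms(1) by (auto intro: order_trans)
qed simp

lemma jump_pair_add:
  fixes B :: "real \<Rightarrow> 'a \<Rightarrow> real ^ 'n"
  assumes "jump_pair T B S c f X" and "jump_pair T B S' d g Y"
  shows "\<exists>R e. jump_pair T B R e (\<lambda>s. f s + g s) (\<lambda>\<omega>. X \<omega> + Y \<omega>)"
proof (intro exI)
  let ?c = "\<lambda>t. if t \<in> S then c t else 0" and ?d = "\<lambda>t. if t \<in> S' then d t else 0"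
  have "finite S" "finite S'" using assms by (auto simp: jump_pair_def)
  \<comment> \<open>Both families are extended by zero to the union. \<open>h\<close> is
    instantiated once with the integrand and once with the integral, so one argument serves both
    members of the pair.\<close>
  then have *: "(\<Sum>t\<in>S. h (c t) t) = (\<Sum>t\<in>S \<union> S'. h (?c t) t)"
      "(\<Sum>t\<in>S'. h (d t) t) = (\<Sum>t\<in>S \<union> S'. h (?d t) t)"
    if "\<And>t. h 0 t = 0" for h :: "real ^ 'n \<Rightarrow> real \<Rightarrow> 'c::comm_monoid_add"
    using that by (auto intro!: sum.mono_neutral_cong_left)
  show "jump_pair T B (S \<union> S') (\<lambda>t. ?c t + ?d t) (\<lambda>s. f s + g s) (\<lambda>\<omega>. X \<omega> + Y \<omega>)"
    using assms
    unfolding jump_pair_def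
    using *[of "\<lambda>x t. indicat_real {0<..t} _ *\<^sub>R x"] *[of "\<lambda>x t. x \<bullet> (B t _ - B 0 _)"]
    by (auto simp: scaleR_add_right inner_add_left sum.distrib)
qed

lemma jump_pair_0: "jump_pair T B {} c (\<lambda>s. 0) (\<lambda>\<omega>. 0)"
  by (simp add: jump_pair_def)

lemma jump_pair_single:
  assumes "0 \<le> t" "t \<le> T"
  shows "\<exists>S d. jump_pair T B S d (\<lambda>s. indicat_real {0<..t} s *\<^sub>R c) (\<lambda>\<omega>. c \<bullet> (B t \<omega> - B 0 \<omega>))"
proof (cases "t = 0")
  \<comment> \<open>Jump times are positive, so time 0 is represented by the empty set; integrand
    and integral both vanish there.\<close>
  case True
  then show ?thesis using jump_pair_0[of T B] by auto
next
  case False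
  then show ?thesis using assms
    by (intro exI[of _ "{t}"] exI[of _ "\<lambda>_. c"]) (simp add: jump_pair_def)
qed

text \<open>The indicator of \<open>{p<..p'}\<close> is the difference of those of
  \<open>{0<..p'}\<close> and \<open>{0<..p}\<close>, and the increment of \<open>B\<close> splits
  in the same way. Each partition interval thus contributes two jumps.\<close>

lemma jump_pair_of_step_pair:
  assumes "step_pair T B f X"
  shows "\<exists>S c. jump_pair T B S c f X"
proof -
  from assms obtain n p c where p: "0 \<le> p 0" "\<forall>k<n. p k \<le> p (Suc k)" "p n \<le> T"
    and fX: "f = step_fun n p c" "X = step_integral B n p c"
    unfolding step_pair_def by blast
  have "m \<le> n \<Longrightarrow> \<exists>S d. jump_pair T B S d (step_fun m p c) (step_integral B m p c)" for m
  proof (induction m)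
    case 0
    then show ?case using jump_pair_0[of T B] by (auto simp: step_fun_def step_integral_def)
  next
    case (Suc m)
    have mono: "0 \<le> p m" "p m \<le> p (Suc m)" "p (Suc m) \<le> T"
      using p step_pair_mono_point[OF p(2), of 0 m] step_pair_mono_point[OF p(2), of "Suc m" n] Suc.prems
      by auto
    from Suc obtain S d where 1: "jump_pair T B S d (step_fun m p c) (step_integral B m p c)" by auto
    obtain S1 d1 where 2: "jump_pair T B S1 d1 (\<lambda>s. indicat_real {0<..p (Suc m)} s *\<^sub>R c m)
        (\<lambda>\<omega>. c m \<bullet> (B (p (Suc m)) \<omega> - B 0 \<omega>))"
      using jump_pair_single[of "p (Suc m)" T B "c m"] mono by auto
    obtain S2 d2 where 3: "jump_pair T B S2 d2 (\<lambda>s. indicat_real {0<..p m} s *\<^sub>R (- c m))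
        (\<lambda>\<omega>. (- c m) \<bullet> (B (p m) \<omega> - B 0 \<omega>))"
      using jump_pair_single[of "p m" T B "- c m"] mono by auto
    from jump_pair_add[OF 2 3] obtain S3 d3 where 4: "jump_pair T B S3 d3
        (\<lambda>s. indicat_real {0<..p (Suc m)} s *\<^sub>R c m + indicat_real {0<..p m} s *\<^sub>R (- c m))
        (\<lambda>\<omega>. c m \<bullet> (B (p (Suc m)) \<omega> - B 0 \<omega>) + (- c m) \<bullet> (B (p m) \<omega> - B 0 \<omega>))" by blast
    have e: "step_fun (Suc m) p c = (\<lambda>s. step_fun m p c s + (indicat_real {0<..p (Suc m)} s *\<^sub>R c m
            + indicat_real {0<..p m} s *\<^sub>R (- c m)))"
      "step_integral B (Suc m) p c = (\<lambda>\<omega>. step_integral B m p c \<omega> + (c m \<bullet> (B (p (Suc m)) \<omega> - B 0 \<omega>)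
            + (- c m) \<bullet> (B (p m) \<omega> - B 0 \<omega>)))"
      using mono by (auto simp: step_fun_def step_integral_def fun_eq_iff indicator_def inner_diff_right)
    show ?case unfolding e by (rule jump_pair_add[OF 1 4])
  qed
  then show ?thesis using fX by blast
qed

text \<open>Induction by adding the largest time \<open>b\<close>. If \<open>m\<close> is the
  largest earlier time (0 if there is none), the indicator of \<open>{0<..b}\<close> is that of
  \<open>{0<..m}\<close> plus that of \<open>{m<..b}\<close>: the first part is absorbed into the
  jump at \<open>m\<close>, the second becomes a new last interval.\<close>

lemma step_pair_of_jump_pair:
  fixes B :: "real \<Rightarrow> 'a \<Rightarrow> real ^ 'n"
  assumes "0 \<le> T" and "jump_pair T B S c f X"
  shows "step_pair T B f X"
proof -
  have "\<exists>n p d. p 0 = 0 \<and> (\<forall>k<n. p k \<le> p (Suc k)) \<and> p n = Max (insert 0 S) \<and>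
          step_fun n p d = (\<lambda>s. \<Sum>t\<in>S. indicat_real {0<..t} s *\<^sub>R c t) \<and>
          step_integral B n p d = (\<lambda>\<omega>. \<Sum>t\<in>S. c t \<bullet> (B t \<omega> - B 0 \<omega>))"
    if "finite S" and "S \<subseteq> {0<..}" for S and c :: "real \<Rightarrow> real ^ 'n"
    using that
  proof (induction S arbitrary: c rule: finite_linorder_max_induct)
    case empty
    show ?case
      by (intro exI[of _ 0] exI[of _ "\<lambda>_. 0"]) (auto simp: step_fun_def step_integral_def)
  next
    case (insert b A)
    define m where "m = Max (insert 0 A)"
    \<comment> \<open>The induction hypothesis is used for this altered family, hence the
      generalisation over \<open>c\<close>.\<close>
    define c' where "c' = c(m := c m + c b)"
    have m: "0 \<le> m" "m < b" "m \<in> insert 0 A"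
      unfolding m_def using insert by (auto intro: Max_ge)
       (metis Max_in finite_insert insert_iff insert_not_empty subset_iff greaterThan_iff)+
    have maxb: "Max (insert 0 (insert b A)) = b"
      using insert by (intro Max_eqI) (auto simp: less_imp_le)
    obtain n p d where IH: "p 0 = 0" "\<forall>k<n. p k \<le> p (Suc k)" "p n = m"
      "step_fun n p d = (\<lambda>s. \<Sum>t\<in>A. indicat_real {0<..t} s *\<^sub>R c' t)"
      "step_integral B n p d = (\<lambda>\<omega>. \<Sum>t\<in>A. c' t \<bullet> (B t \<omega> - B 0 \<omega>))"
      using insert.IH[of c'] insert.prems unfolding m_def by auto
    \<comment> \<open>The condition at time 0 handles the case where there is no earlier time: then
      \<open>m = 0\<close> lies outside \<open>A\<close>, and the absorbed term is zero.\<close>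
    have split: "(\<Sum>t\<in>A. h t (c' t)) = (\<Sum>t\<in>A. h t (c t)) + h m (c b)"
      if h: "\<And>t x y. h t (x + y) = h t x + h t y" "\<And>x. h 0 x = 0" for h :: "real \<Rightarrow> real ^ 'n \<Rightarrow> 'c::real_vector"
    proof (cases "m \<in> A")
      case True
      then have "(\<Sum>t\<in>A. h t (c' t)) = h m (c m + c b) + (\<Sum>t\<in>A - {m}. h t (c t))"
        using insert.hyps(1) by (subst sum.remove[of A m]) (auto simp: c'_def intro!: sum.cong)
      also have "\<dots> = (\<Sum>t\<in>A. h t (c t)) + h m (c b)"
        using True insert.hyps(1) by (subst sum.remove[of A m]) (auto simp: h)
      finally show ?thesis .
    next
      case False
      then have "m = 0" using m by auto
      then show ?thesis using False by (auto simp: h c'_def intro!: sum.cong)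
    qed
    let ?p = "p(Suc n := b)" and ?d = "d(n := c b)"
    have "b \<notin> A" using insert.hyps by auto
    have f: "step_fun (Suc n) ?p ?d = (\<lambda>s. step_fun n p d s + indicat_real {m<..b} s *\<^sub>R c b)"
      "step_integral B (Suc n) ?p ?d = (\<lambda>\<omega>. step_integral B n p d \<omega> + c b \<bullet> (B b \<omega> - B m \<omega>))"
      using IH(3) by (auto simp: step_fun_def step_integral_def fun_eq_iff intro!: sum.cong)
    show ?case
    proof (intro exI conjI)
      show "step_fun (Suc n) ?p ?d = (\<lambda>s. \<Sum>t\<in>insert b A. indicat_real {0<..t} s *\<^sub>R c t)"
        unfolding f IH(4)
        using m \<open>b \<notin> A\<close> insert.hyps(1)
          split[of "\<lambda>t x. indicat_real {0<..t} _ *\<^sub>R x"]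
        by (auto simp: fun_eq_iff scaleR_add_right indicator_def)
      show "step_integral B (Suc n) ?p ?d = (\<lambda>\<omega>. \<Sum>t\<in>insert b A. c t \<bullet> (B t \<omega> - B 0 \<omega>))"
        unfolding f IH(5)
        using \<open>b \<notin> A\<close> insert.hyps(1)
          split[of "\<lambda>t x. x \<bullet> (B t _ - B 0 _)"]
        by (auto simp: fun_eq_iff inner_add_left inner_diff_right)
    qed (use IH m maxb in \<open>auto simp: less_Suc_eq\<close>)
  qed
  from this[of S c] obtain n p d where *: "p 0 = 0" "\<forall>k<n. p k \<le> p (Suc k)" "p n = Max (insert 0 S)"
      "step_fun n p d = f" "step_integral B n p d = X"
    using assms unfolding jump_pair_def by (smt (verit) greaterThanAtMost_iff greaterThan_iff subset_iff)
  moreover have "Max (insert 0 S) \<le> T"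
    using assms by (subst Max_le_iff) (auto simp: jump_pair_def)
  ultimately show ?thesis
    unfolding step_pair_def by (intro exI[of _ n] exI[of _ p] exI[of _ d]) auto
qed

lemma step_pair_add:
  assumes "0 \<le> T" "step_pair T B f X" "step_pair T B g Y"
  shows "step_pair T B (\<lambda>s. f s + g s) (\<lambda>\<omega>. X \<omega> + Y \<omega>)"
proof -
  obtain S c S' d where "jump_pair T B S c f X" "jump_pair T B S' d g Y"
    using jump_pair_of_step_pair assms(2,3) by blast
  from jump_pair_add[OF this] show ?thesis
    using step_pair_of_jump_pair[OF assms(1)] by blast
qed

lemma step_pair_scale:
  assumes "step_pair T B f X"
  shows "step_pair T B (\<lambda>s. r *\<^sub>R f s) (\<lambda>\<omega>. r * X \<omega>)"
proof -
  from assms obtain n p c where p: "0 \<le> p 0" "\<forall>k<n. p k \<le> p (Suc k)" "p n \<le> T"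
    and fX: "f = step_fun n p c" "X = step_integral B n p c"
    unfolding step_pair_def by blast
  then show ?thesis unfolding step_pair_def
    by (intro exI[of _ n] exI[of _ p] exI[of _ "\<lambda>k. r *\<^sub>R c k"])
       (auto simp: step_fun_def step_integral_def fun_eq_iff scaleR_sum_right sum_distrib_left mult_ac
         intro!: sum.cong)
qed

lemma step_pair_diff:
  assumes "0 \<le> T" "step_pair T B f X" "step_pair T B g Y"
  shows "step_pair T B (\<lambda>s. f s - g s) (\<lambda>\<omega>. X \<omega> - Y \<omega>)"
  using step_pair_add[OF assms(1,2) step_pair_scale[OF assms(3), of "-1"]] by simp

lemma step_pair_single:
  assumes "0 \<le> t" "t \<le> T"
  shows "\<exists>X. step_pair T B (\<lambda>s. indicat_real {0<..t} s *\<^sub>R c) X"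
  using jump_pair_single[OF assms, of B c] step_pair_of_jump_pair assms by (meson order_trans)

lemma step_fun_measurable [measurable]: "step_fun n p c \<in> borel_measurable borel"
  unfolding step_fun_def by measurable

subsection \<open>Squared norms\<close>

text \<open>The squared L^2 norm, used both for integrands on the time interval and for random
  variables. Values in \<open>ennreal\<close> allow estimates before finiteness is known.\<close>

definition sqint :: "'a measure \<Rightarrow> ('a \<Rightarrow> 'v::real_normed_vector) \<Rightarrow> ennreal" where
  "sqint N f = (\<integral>\<^sup>+x. ennreal ((norm (f x))\<^sup>2) \<partial>N)"

text \<open>Young's inequality with a weight. With \<delta> = 1 it gives the factors 2 found in most
  estimates below; a small \<delta> is what makes the norm continuous in
  \<open>tendsto_sqint\<close>.\<close>

lemma norm_add_squared_le:
  fixes u v :: "'v::real_normed_vector"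
  assumes "\<delta> > 0"
  shows "(norm (u + v))\<^sup>2 \<le> (1 + \<delta>) * (norm u)\<^sup>2 + (1 + 1 / \<delta>) * (norm v)\<^sup>2"
proof -
  have "(norm (u + v))\<^sup>2 \<le> (norm u + norm v)\<^sup>2"
    by (simp add: norm_triangle_ineq power_mono)
  also have "\<dots> \<le> (1 + \<delta>) * (norm u)\<^sup>2 + (1 + 1 / \<delta>) * (norm v)\<^sup>2"
  proof -
    have "0 \<le> (\<delta> * norm u - norm v)\<^sup>2 / \<delta>" using assms by simp
    then show ?thesis using assms by (simp add: field_simps power2_eq_square)
  qed
  finally show ?thesis .
qed

text \<open>Stands in for Minkowski's inequality and avoids square roots of extended reals.\<close>

lemma sqint_add_le:
  fixes u v :: "'a \<Rightarrow> 'v::euclidean_space"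
  assumes [measurable]: "u \<in> borel_measurable N" "v \<in> borel_measurable N" and "\<delta> > 0"
  shows "sqint N (\<lambda>x. u x + v x) \<le> ennreal (1 + \<delta>) * sqint N u + ennreal (1 + 1 / \<delta>) * sqint N v"
proof -
  have "sqint N (\<lambda>x. u x + v x)
      \<le> (\<integral>\<^sup>+x. ennreal (1 + \<delta>) * ennreal ((norm (u x))\<^sup>2) + ennreal (1 + 1 / \<delta>) * ennreal ((norm (v x))\<^sup>2) \<partial>N)"
    unfolding sqint_def using norm_add_squared_le[OF assms(3)] assms(3)
    by (intro nn_integral_mono) (simp flip: ennreal_mult ennreal_plus)
  also have "\<dots> = ennreal (1 + \<delta>) * sqint N u + ennreal (1 + 1 / \<delta>) * sqint N v"
    unfolding sqint_def by (subst nn_integral_add) (simp_all add: nn_integral_cmult)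
  finally show ?thesis .
qed

lemma sqint_scale: 
  fixes u :: "'a \<Rightarrow> 'v::euclidean_space"
  assumes [measurable]: "u \<in> borel_measurable N"
  shows "sqint N (\<lambda>x. r *\<^sub>R u x) = ennreal (r\<^sup>2) * sqint N u"
  unfolding sqint_def by (simp add: power_mult_distrib ennreal_mult nn_integral_cmult)

lemma sqint_minus_commute: "sqint N (\<lambda>x. u x - v x) = sqint N (\<lambda>x. v x - u x)"
  by (simp add: sqint_def norm_minus_commute)

lemma sqint_tendsto_0_add:
  fixes u v :: "nat \<Rightarrow> 'a \<Rightarrow> 'v::euclidean_space"
  assumes [measurable]: "\<And>m. u m \<in> borel_measurable N" "\<And>m. v m \<in> borel_measurable N"
    and "(\<lambda>m. sqint N (u m)) \<longlonglongrightarrow> 0" "(\<lambda>m. sqint N (v m)) \<longlonglongrightarrow> 0"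
  shows "(\<lambda>m. sqint N (\<lambda>x. u m x + v m x)) \<longlonglongrightarrow> 0"
proof (rule tendsto_sandwich[where f = "\<lambda>_. 0"])
  show "\<forall>\<^sub>F m in sequentially. sqint N (\<lambda>x. u m x + v m x) \<le> ennreal (1 + 1) * sqint N (u m) + ennreal (1 + 1 / 1) * sqint N (v m)"
    by (intro always_eventually allI sqint_add_le) auto
  have "(\<lambda>m. ennreal (1 + 1) * sqint N (u m) + ennreal (1 + 1 / 1) * sqint N (v m))
    \<longlonglongrightarrow> ennreal (1 + 1) * 0 + ennreal (1 + 1 / 1) * 0"
    using assms by (intro tendsto_add ennreal_tendsto_cmult) auto
  then show "(\<lambda>m. ennreal (1 + 1) * sqint N (u m) + ennreal (1 + 1 / 1) * sqint N (v m)) \<longlonglongrightarrow> 0"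
    by simp
qed auto

lemma sqint_add_finite:
  fixes u v :: "'a \<Rightarrow> 'v::euclidean_space"
  assumes [measurable]: "u \<in> borel_measurable N" "v \<in> borel_measurable N"
    and "sqint N u < \<infinity>" "sqint N v < \<infinity>"
  shows "sqint N (\<lambda>x. u x + v x) < \<infinity>"
  using sqint_add_le[of u N v 1] assms by (auto simp: ennreal_mult_less_top intro: le_less_trans)

text \<open>The weighted triangle inequality is applied in both directions, from \<open>f\<close> to
  \<open>u m\<close> and back. For fixed \<delta> the distance term tends to 0, and what remains is
  a relative error \<delta>.\<close>

lemma tendsto_sqint:
  fixes f :: "'a \<Rightarrow> 'v::euclidean_space"
  assumes [measurable]: "f \<in> borel_measurable N" "\<And>m. u m \<in> borel_measurable N"
    and lim: "(\<lambda>m. sqint N (\<lambda>x. f x - u m x)) \<longlonglongrightarrow> 0" and fin: "sqint N f < \<infinity>"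
  shows "(\<lambda>m. enn2real (sqint N (u m))) \<longlonglongrightarrow> enn2real (sqint N f)"
    and "eventually (\<lambda>m. sqint N (u m) < \<infinity>) sequentially"
proof -
  have ev1: "eventually (\<lambda>m. sqint N (\<lambda>x. f x - u m x) < 1) sequentially"
    using lim by (rule order_tendstoD) simp
  have *: "sqint N (\<lambda>x. u m x - f x) = sqint N (\<lambda>x. f x - u m x)" for m
    by (rule sqint_minus_commute)
  show ev: "eventually (\<lambda>m. sqint N (u m) < \<infinity>) sequentially"
    using ev1
  proof eventually_elim
    case (elim m)
    then have "sqint N (\<lambda>x. u m x - f x) < \<infinity>"
      unfolding * using less_trans by fastforce
    then show ?case
      using sqint_add_finite[of f N "\<lambda>x. u m x - f x"] fin by simp
  qed
  define e where "e m = enn2real (sqint N (\<lambda>x. f x - u m x))" for m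
  have e0: "e \<longlonglongrightarrow> 0"
    using tendsto_enn2real[OF lim[folded ennreal_0]] unfolding e_def by simp
  define q where "q = enn2real (sqint N f)"
  define r where "r m = enn2real (sqint N (u m))" for m
  have nn: "0 \<le> q" "0 \<le> r m" "0 \<le> e m" for m
    by (auto simp: q_def r_def e_def)
  have ineq: "eventually (\<lambda>m. r m \<le> (1 + \<delta>) * q + (1 + 1 / \<delta>) * e m
      \<and> q \<le> (1 + \<delta>) * r m + (1 + 1 / \<delta>) * e m) sequentially" if "\<delta> > 0" for \<delta>
    using ev1 ev
  proof eventually_elim
    case (elim m)
    then have fin': "sqint N (\<lambda>x. f x - u m x) < \<infinity>"
      using less_trans by fastforce
    have 1: "sqint N (u m) \<le> ennreal (1 + \<delta>) * sqint N f + ennreal (1 + 1 / \<delta>) * sqint N (\<lambda>x. f x - u m x)"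
      using sqint_add_le[of f N "\<lambda>x. u m x - f x" \<delta>] that by (simp add: *)
    have 2: "sqint N f \<le> ennreal (1 + \<delta>) * sqint N (u m) + ennreal (1 + 1 / \<delta>) * sqint N (\<lambda>x. f x - u m x)"
      using sqint_add_le[of "u m" N "\<lambda>x. f x - u m x" \<delta>] that by simp
    have fin3: "sqint N f = ennreal q" "sqint N (u m) = ennreal (r m)"
      "sqint N (\<lambda>x. f x - u m x) = ennreal (e m)"
      using fin fin' elim unfolding e_def q_def r_def by (auto simp: ennreal_enn2real_if)
    have pos: "0 \<le> 1 + \<delta>" "0 \<le> 1 + 1 / \<delta>" using that by auto
    have eq: "ennreal (1 + \<delta>) * ennreal x + ennreal (1 + 1 / \<delta>) * ennreal y = ennreal ((1 + \<delta>) * x + (1 + 1 / \<delta>) * y)"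
      if "0 \<le> x" "0 \<le> y" for x y
      using that pos by (simp only: ennreal_mult ennreal_plus mult_nonneg_nonneg)
    have "r m \<le> (1 + \<delta>) * q + (1 + 1 / \<delta>) * e m"
      using 1 nn pos unfolding fin3 eq[OF nn(1,3)] by (subst (asm) ennreal_le_iff) auto
    moreover have "q \<le> (1 + \<delta>) * r m + (1 + 1 / \<delta>) * e m"
      using 2 nn pos unfolding fin3 eq[OF nn(2,3)] by (subst (asm) ennreal_le_iff) auto
    ultimately show ?case ..
  qed
  have "r \<longlonglongrightarrow> q"
  proof (rule LIMSEQ_I)
    fix \<epsilon> :: real assume "\<epsilon> > 0"
    \<comment> \<open>Chosen so that \<open>\<delta> * q\<close> is at most \<epsilon>/8; the
      summand 1 covers \<open>q = 0\<close>, and \<delta> \<le> 1 is used to bound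
      \<open>\<delta> * r m\<close> in the reverse direction.\<close>
    define \<delta> where "\<delta> = min 1 (\<epsilon> / (8 * (q + 1)))"
    note q = nn(1)
    have \<delta>: "\<delta> > 0" "\<delta> \<le> 1" "\<delta> * q \<le> \<epsilon> / 8"
    proof -
      show "\<delta> > 0" "\<delta> \<le> 1" using \<open>\<epsilon> > 0\<close> q by (auto simp: \<delta>_def intro!: divide_pos_pos)
      have "\<delta> * q \<le> \<epsilon> / (8 * (q + 1)) * q"
        using q by (intro mult_right_mono) (auto simp: \<delta>_def)
      also have "\<dots> = \<epsilon> / 8 * (q / (q + 1))" by simp
      also have "\<dots> \<le> \<epsilon> / 8 * 1"
        using q \<open>\<epsilon> > 0\<close> by (intro mult_left_mono) auto
      also have "\<dots> = \<epsilon> / 8" by simp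
      finally show "\<delta> * q \<le> \<epsilon> / 8" .
    qed
    have "(\<lambda>m. (1 + 1 / \<delta>) * e m) \<longlonglongrightarrow> (1 + 1 / \<delta>) * 0"
      by (intro tendsto_intros e0)
    then have "eventually (\<lambda>m. (1 + 1 / \<delta>) * e m < \<epsilon> / 8) sequentially"
      using \<open>\<epsilon> > 0\<close> by (intro order_tendstoD) auto
    with ineq[OF \<delta>(1)] have "eventually (\<lambda>m. norm (r m - q) < \<epsilon>) sequentially"
    proof eventually_elim
      case (elim m)
      define E where "E = (1 + 1 / \<delta>) * e m"
      have E: "r m \<le> q + \<delta> * q + E" "q \<le> r m + \<delta> * r m + E" "E < \<epsilon> / 8"
        using elim unfolding E_def[symmetric] by (simp_all only: distrib_right mult_1)
      have rm: "r m \<le> q + \<epsilon> / 4" using E \<delta>(3) by linarith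
      have "\<delta> * r m \<le> \<delta> * (q + \<epsilon> / 4)"
        by (rule mult_left_mono[OF rm less_imp_le[OF \<delta>(1)]])
      also have "\<dots> = \<delta> * q + \<delta> * (\<epsilon> / 4)" by (rule distrib_left)
      also have "\<delta> * (\<epsilon> / 4) \<le> 1 * (\<epsilon> / 4)"
        using \<open>\<epsilon> > 0\<close> by (intro mult_right_mono \<delta>(2)) linarith
      finally have "\<delta> * r m \<le> \<epsilon> / 8 + \<epsilon> / 4" using \<delta>(3) by linarith
      then show ?case using rm E(2,3) \<open>\<epsilon> > 0\<close> unfolding real_norm_def abs_less_iff by linarith
    qed
    then show "\<exists>no. \<forall>n\<ge>no. norm (r n - q) < \<epsilon>"
      by (simp add: eventually_sequentially)
  qed
  then show "(\<lambda>m. enn2real (sqint N (u m))) \<longlonglongrightarrow> enn2real (sqint N f)"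
    unfolding q_def r_def .
qed

abbreviation time_measure :: "real \<Rightarrow> real measure" where
  "time_measure T \<equiv> restrict_space lborel {0..T}"

text \<open>The half-open intervals are disjoint, so the square of the sum has no cross
  terms.\<close>

lemma sqint_step_fun:
  assumes "0 \<le> p 0" "\<forall>k<n. p k \<le> p (Suc k)" "p n \<le> T"
  shows "sqint (time_measure T) (step_fun n p c) = ennreal (\<Sum>k<n. (p (Suc k) - p k) * (norm (c k))\<^sup>2)"
proof -
  \<comment> \<open>To the right of \<open>p m\<close> the first \<open>m\<close> summands vanish;
    hence on the next interval only the new summand is present.\<close>
  have zero: "step_fun m p c s = 0" if "p m < s" "m \<le> n" for m s
  proof -
    have "p (Suc k) < s" if "k < m" for k
      using step_pair_mono_point[OF assms(2), of "Suc k" m] that \<open>p m < s\<close> \<open>m \<le> n\<close> by linarith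
    then have "s \<notin> {p k<..p (Suc k)}" if "k < m" for k
      using that by (meson greaterThanAtMost_iff not_le)
    then show ?thesis by (simp add: step_fun_def)
  qed
  have sq: "m \<le> n \<Longrightarrow> (norm (step_fun m p c s))\<^sup>2 = (\<Sum>k<m. indicat_real {p k<..p (Suc k)} s * (norm (c k))\<^sup>2)" for m s
  proof (induction m)
    case 0
    then show ?case by (simp add: step_fun_def)
  next
    case (Suc m)
    have e: "step_fun (Suc m) p c s = step_fun m p c s + indicat_real {p m<..p (Suc m)} s *\<^sub>R c m"
      by (simp add: step_fun_def)
    show ?case
    proof (cases "s \<in> {p m<..p (Suc m)}")
      case True
      then have "step_fun m p c s = 0" using zero[of m s] Suc.prems by auto
      then show ?thesis using Suc True unfolding e by (simp add: indicator_def)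
    next
      case False
      then show ?thesis using Suc unfolding e by (auto simp: indicator_def)
    qed
  qed
  have "sqint (time_measure T) (step_fun n p c)
      = (\<integral>\<^sup>+s. (\<Sum>k<n. ennreal (indicat_real {p k<..p (Suc k)} s * (norm (c k))\<^sup>2)) * indicator {0..T} s \<partial>lborel)"
    unfolding sqint_def by (subst nn_integral_restrict_space) (simp_all add: sq sum_ennreal)
  also have "\<dots> = (\<integral>\<^sup>+s. (\<Sum>k<n. ennreal ((norm (c k))\<^sup>2) * indicator {p k<..p (Suc k)} s) \<partial>lborel)"
  proof (intro nn_integral_cong)
    fix s
    have b: "0 \<le> p k \<and> p (Suc k) \<le> T" if "k < n" for k
      using step_pair_mono_point[OF assms(2), of 0 k] step_pair_mono_point[OF assms(2), of "Suc k" n] that assms by auto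
    show "(\<Sum>k<n. ennreal (indicat_real {p k<..p (Suc k)} s * (norm (c k))\<^sup>2)) * indicator {0..T} s
      = (\<Sum>k<n. ennreal ((norm (c k))\<^sup>2) * indicator {p k<..p (Suc k)} s)"
      unfolding sum_distrib_right
    proof (intro sum.cong refl)
      fix k assume "k \<in> {..<n}"
      then have "s \<in> {p k<..p (Suc k)} \<Longrightarrow> s \<in> {0..T}" using b[of k] by auto
      then show "ennreal (indicat_real {p k<..p (Suc k)} s * (norm (c k))\<^sup>2) * indicator {0..T} s
          = ennreal ((norm (c k))\<^sup>2) * indicator {p k<..p (Suc k)} s"
        by (cases "s \<in> {p k<..p (Suc k)}") (simp_all only: indicator_simps, simp_all)
    qed
  qed
  also have "\<dots> = (\<Sum>k<n. ennreal ((p (Suc k) - p k) * (norm (c k))\<^sup>2))"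
    using assms(2) by (subst nn_integral_sum) (auto simp: nn_integral_cmult ennreal_mult mult.commute intro!: sum.cong)
  also have "\<dots> = ennreal (\<Sum>k<n. (p (Suc k) - p k) * (norm (c k))\<^sup>2)"
    using assms(2) by (intro sum_ennreal) auto
  finally show ?thesis .
qed

subsection \<open>Exponential moments of step integrals\<close>

locale brownian = prob_space M for M :: "'a measure" +
  fixes T :: real and F :: "real \<Rightarrow> 'a measure" and B :: "real \<Rightarrow> 'a \<Rightarrow> real ^ 'n"
  assumes T_pos: "0 < T" and filtration: "filtration_on M T F" and brownian: "brownian_motion M T F B"
begin

section \<open>Measurability along the filtration and independence of increments\<close>

lemma space_F: "t \<in> {0..T} \<Longrightarrow> space (F t) = space M"
  using filtration by (auto simp: filtration_on_def subalgebra_def)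

lemma F_measurable_M:
  assumes "t \<in> {0..T}" "X \<in> measurable (F t) N" shows "X \<in> measurable M N"
  using assms filtration measurable_from_subalg unfolding filtration_on_def by blast

lemma F_measurable_mono:
  assumes "0 \<le> s" "s \<le> t" "t \<le> T" "X \<in> measurable (F s) N" shows "X \<in> measurable (F t) N"
proof (rule measurable_from_subalg[OF _ assms(4)])
  show "subalgebra (F t) (F s)"
    using assms filtration space_F[of s] space_F[of t] by (auto simp: filtration_on_def subalgebra_def)
qed

lemma B_measurable_F: "t \<in> {0..T} \<Longrightarrow> B t \<in> borel_measurable (F t)"
  using brownian by (auto simp: brownian_motion_def)

lemma B_measurable [measurable]: "t \<in> {0..T} \<Longrightarrow> B t \<in> borel_measurable M"
  using B_measurable_F F_measurable_M by blast

lemma increment_exp_moment: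
  assumes "0 \<le> s" "s < t" "t \<le> T"
  shows "integrable M (\<lambda>\<omega>. exp (c \<bullet> (B t \<omega> - B s \<omega>)))"
    and "expectation (\<lambda>\<omega>. exp (c \<bullet> (B t \<omega> - B s \<omega>))) = exp ((t - s) * (norm c)\<^sup>2 / 2)"
proof -
  have [measurable]: "B t \<in> borel_measurable M" "B s \<in> borel_measurable M" using assms by auto
  have "distributed M lborel (\<lambda>\<omega>. B t \<omega> - B s \<omega>)
          (\<lambda>x. ennreal (\<Prod>i\<in>UNIV. normal_density 0 (sqrt (t - s)) (x $ i)))"
    using brownian assms by (auto simp: brownian_motion_def)
  from distributed_nn_integral[OF this, of "\<lambda>x. ennreal (exp (c \<bullet> x))", symmetric]
  have "(\<integral>\<^sup>+\<omega>. ennreal (exp (c \<bullet> (B t \<omega> - B s \<omega>))) \<partial>M) = ennreal (exp ((t - s) * (norm c)\<^sup>2 / 2))"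
    using nn_integral_normal_prod_exp[of "sqrt (t - s)" c] assms by simp
  then have "integrable M (\<lambda>\<omega>. exp (c \<bullet> (B t \<omega> - B s \<omega>))) \<and>
     expectation (\<lambda>\<omega>. exp (c \<bullet> (B t \<omega> - B s \<omega>))) = exp ((t - s) * (norm c)\<^sup>2 / 2)"
    by (subst (asm) nn_integral_eq_integrable) auto
  then show "integrable M (\<lambda>\<omega>. exp (c \<bullet> (B t \<omega> - B s \<omega>)))"
    "expectation (\<lambda>\<omega>. exp (c \<bullet> (B t \<omega> - B s \<omega>))) = exp ((t - s) * (norm c)\<^sup>2 / 2)" by auto
qed

lemma indep_set_mono: "indep_set \<A> \<B> \<Longrightarrow> \<A>' \<subseteq> \<A> \<Longrightarrow> \<B>' \<subseteq> \<B> \<Longrightarrow> indep_set \<A>' \<B>'"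
  unfolding indep_sets2_eq by blast

text \<open>Turns independence of \<sigma>-algebras into independence of random variables: the
  events of \<open>X\<close> lie in \<open>F s\<close>, those of \<open>g\<close> of the increment
  lie in the algebra generated by the increment.\<close>

lemma indep_increment:
  assumes st: "0 \<le> s" "s < t" "t \<le> T" and X: "X \<in> borel_measurable (F s)"
    and g[measurable]: "g \<in> borel_measurable borel"
  shows "indep_var borel X borel (\<lambda>\<omega>. g (B t \<omega> - B s \<omega>))"
proof -
  let ?D = "\<lambda>\<omega>. B t \<omega> - B s \<omega>"
  let ?V = "vimage_algebra (space M) ?D borel"
  have [measurable]: "B t \<in> borel_measurable M" "B s \<in> borel_measurable M" using st by auto
  have ind: "indep_set (sets (F s)) (sets ?V)"
    using brownian st by (auto simp: brownian_motion_def)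
  have sp: "space (F s) = space M" using st by (intro space_F) auto
  have "{X -` A \<inter> space M |A. A \<in> sets borel} \<subseteq> sets (F s)"
    using measurable_sets[OF X] by (auto simp: sp)
  then have 1: "sigma_sets (space M) {X -` A \<inter> space M |A. A \<in> sets borel} \<subseteq> sets (F s)"
    using sets.sigma_sets_subset[of _ "F s"] sp by simp
  have "(\<lambda>\<omega>. g (?D \<omega>)) -` A \<inter> space M \<in> sets ?V" if "A \<in> sets borel" for A
  proof -
    have "(\<lambda>\<omega>. g (?D \<omega>)) -` A \<inter> space M = ?D -` (g -` A) \<inter> space M" by auto
    moreover have "g -` A \<in> sets borel" using measurable_sets[OF g that] by simp
    ultimately show ?thesis by (simp add: in_vimage_algebra)
  qed
  then have 2: "sigma_sets (space M) {(\<lambda>\<omega>. g (?D \<omega>)) -` A \<inter> space M |A. A \<in> sets borel} \<subseteq> sets ?V"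
    using sets.sigma_sets_subset[of "{(\<lambda>\<omega>. g (?D \<omega>)) -` A \<inter> space M |A. A \<in> sets borel}" ?V]
    by (simp only: space_vimage_algebra) blast
  show ?thesis unfolding indep_var_eq
  proof (intro conjI)
    show "random_variable borel X"
      by (rule F_measurable_M[OF _ X]) (use st in auto)
    show "indep_set (sigma_sets (space M) {X -` A \<inter> space M |A. A \<in> sets borel})
      (sigma_sets (space M) {(\<lambda>\<omega>. g (?D \<omega>)) -` A \<inter> space M |A. A \<in> sets borel})"
      by (rule indep_set_mono[OF ind 1 2])
    show "random_variable borel (\<lambda>\<omega>. g (?D \<omega>))" by measurable
  qed
qed

text \<open>Adaptedness is part of the induction: since the partial sum is measurable at time
  \<open>p m\<close>, it is independent of the next increment, and the expectation of the product of
  exponentials factors.\<close>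

lemma step_integral_exp_moment:
  assumes p: "0 \<le> p 0" "\<forall>k<n. p k \<le> p (Suc k)" "p n \<le> T" and "m \<le> n"
  shows "step_integral B m p c \<in> borel_measurable (F (p m)) \<and>
    integrable M (\<lambda>\<omega>. exp (step_integral B m p c \<omega>)) \<and>
    expectation (\<lambda>\<omega>. exp (step_integral B m p c \<omega>)) = exp ((\<Sum>k<m. (p (Suc k) - p k) * (norm (c k))\<^sup>2) / 2)"
  using \<open>m \<le> n\<close>
proof (induction m)
  case 0
  then show ?case by (auto simp: step_integral_def[abs_def] prob_space)
next
  case (Suc m)
  have b: "0 \<le> p m" "p m \<le> p (Suc m)" "p (Suc m) \<le> T"
    using step_pair_mono_point[OF p(2), of 0 m] step_pair_mono_point[OF p(2), of "Suc m" n] p Suc.prems by auto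
  let ?X = "step_integral B m p c" and ?D = "\<lambda>\<omega>. c m \<bullet> (B (p (Suc m)) \<omega> - B (p m) \<omega>)"
  have e: "step_integral B (Suc m) p c = (\<lambda>\<omega>. ?X \<omega> + ?D \<omega>)"
    by (simp add: step_integral_def fun_eq_iff)
  have IH: "?X \<in> borel_measurable (F (p m))" "integrable M (\<lambda>\<omega>. exp (?X \<omega>))"
    "expectation (\<lambda>\<omega>. exp (?X \<omega>)) = exp ((\<Sum>k<m. (p (Suc k) - p k) * (norm (c k))\<^sup>2) / 2)"
    using Suc by auto
  have m[measurable]: "?X \<in> borel_measurable (F (p (Suc m)))"
    "B (p (Suc m)) \<in> borel_measurable (F (p (Suc m)))" "B (p m) \<in> borel_measurable (F (p (Suc m)))"
    using F_measurable_mono[OF b] B_measurable_F[of "p m"] B_measurable_F[of "p (Suc m)"] IH(1) b by auto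
  have "(\<lambda>\<omega>. ?X \<omega> + ?D \<omega>) \<in> borel_measurable (F (p (Suc m)))"
    by measurable
  moreover have "integrable M (\<lambda>\<omega>. exp (?X \<omega> + ?D \<omega>)) \<and> expectation (\<lambda>\<omega>. exp (?X \<omega> + ?D \<omega>))
      = exp ((\<Sum>k<Suc m. (p (Suc k) - p k) * (norm (c k))\<^sup>2) / 2)"
  \<comment> \<open>Partitions are only weakly increasing, while the law and independence of
    increments are given for distinct times; a degenerate interval contributes nothing.\<close>
  proof (cases "p m = p (Suc m)")
    case True
    then show ?thesis using IH by simp
  next
    case False
    then have lt: "p m < p (Suc m)" using b by simp
    have ind: "indep_var borel (\<lambda>\<omega>. exp (?X \<omega>)) borel (\<lambda>\<omega>. exp (?D \<omega>))"
    proof (rule indep_increment[OF b(1) lt b(3), of _ "\<lambda>x. exp (c m \<bullet> x)"])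
      show "(\<lambda>\<omega>. exp (?X \<omega>)) \<in> borel_measurable (F (p m))"
        by (rule measurable_compose[OF IH(1)]) measurable
      show "(\<lambda>x. exp (c m \<bullet> x)) \<in> borel_measurable borel"
        by (intro borel_measurable_continuous_onI continuous_intros)
    qed
    note D = increment_exp_moment[OF b(1) lt b(3), of "c m"]
    show ?thesis
      using indep_var_integrable[OF ind IH(2) D(1)] indep_var_lebesgue_integral[OF ind IH(2) D(1)]
      by (simp add: exp_add IH(3) D(2) add_divide_distrib)
  qed
  ultimately show ?case unfolding e by blast
qed

lemma step_pair_measurable:
  assumes "step_pair T B f X"
  shows "f \<in> borel_measurable borel" "X \<in> borel_measurable M"
    "sqint (time_measure T) f < \<infinity>"
proof -
  from assms obtain n p c where p: "0 \<le> p 0" "\<forall>k<n. p k \<le> p (Suc k)" "p n \<le> T"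
    and fX: "f = step_fun n p c" "X = step_integral B n p c"
    unfolding step_pair_def by blast
  show "f \<in> borel_measurable borel" unfolding fX by measurable
  have "p n \<in> {0..T}" using step_pair_mono_point[OF p(2), of 0 n] p by auto
  then show "X \<in> borel_measurable M" using step_integral_exp_moment[OF p order_refl, of c] F_measurable_M
    unfolding fX by blast
  show "sqint (time_measure T) f < \<infinity>" unfolding fX sqint_step_fun[OF p] by simp
qed

lemma step_pair_exp_moment:
  assumes "step_pair T B f X"
  shows "(\<integral>\<^sup>+\<omega>. ennreal (exp (X \<omega>)) \<partial>M) = ennreal (exp (enn2real (sqint (time_measure T) f) / 2))"
proof -
  from assms obtain n p c where p: "0 \<le> p 0" "\<forall>k<n. p k \<le> p (Suc k)" "p n \<le> T"
    and fX: "f = step_fun n p c" "X = step_integral B n p c"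
    unfolding step_pair_def by blast
  have "0 \<le> (\<Sum>k<n. (p (Suc k) - p k) * (norm (c k))\<^sup>2)"
    using p(2) by (intro sum_nonneg) auto
  then show ?thesis
    using step_integral_exp_moment[OF p order_refl, of c] unfolding fX sqint_step_fun[OF p]
    by (subst nn_integral_eq_integral) auto
qed

end

subsection \<open>Wiener integrals\<close>

text \<open>The bound is nonnegativity of the variance of \<open>\<bar>Y\<bar>\<close>. It carries
  L^2 convergence over to L^1, where results on almost surely convergent subsequences apply.\<close>

lemma (in prob_space) L1_le_sqint:
  fixes Y :: "'a \<Rightarrow> real"
  assumes [measurable]: "Y \<in> borel_measurable M" and fin: "sqint M Y < \<infinity>"
  shows "integrable M Y" and "expectation (\<lambda>\<omega>. \<bar>Y \<omega>\<bar>) \<le> sqrt (enn2real (sqint M Y))"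
proof -
  have sq: "integrable M (\<lambda>\<omega>. (Y \<omega>)\<^sup>2)"
    using fin unfolding sqint_def by (intro integrableI_nonneg) auto
  then show int: "integrable M Y"
    by (rule square_integrable_imp_integrable[OF assms(1)])
  have "0 \<le> variance (\<lambda>\<omega>. \<bar>Y \<omega>\<bar>)" by (rule variance_positive)
  also have "\<dots> = expectation (\<lambda>\<omega>. (Y \<omega>)\<^sup>2) - (expectation (\<lambda>\<omega>. \<bar>Y \<omega>\<bar>))\<^sup>2"
    using int sq by (subst variance_eq) auto
  also have "expectation (\<lambda>\<omega>. (Y \<omega>)\<^sup>2) = enn2real (sqint M Y)"
    unfolding sqint_def by (subst integral_eq_nn_integral) auto
  finally show "expectation (\<lambda>\<omega>. \<bar>Y \<omega>\<bar>) \<le> sqrt (enn2real (sqint M Y))"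
    by (intro real_le_rsqrt) simp
qed

lemma (in prob_space) sqint_tendsto_0_AE_subseq:
  fixes u :: "nat \<Rightarrow> 'a \<Rightarrow> real"
  assumes [measurable]: "\<And>m. u m \<in> borel_measurable M" and fin: "\<And>m. sqint M (u m) < \<infinity>"
    and lim: "(\<lambda>m. sqint M (u m)) \<longlonglongrightarrow> 0"
  obtains r :: "nat \<Rightarrow> nat" where "strict_mono r" "AE \<omega> in M. (\<lambda>m. u (r m) \<omega>) \<longlonglongrightarrow> 0"
proof -
  have "(\<lambda>m. sqrt (enn2real (sqint M (u m)))) \<longlonglongrightarrow> sqrt 0"
    using tendsto_enn2real[OF lim[folded ennreal_0]] by (intro tendsto_real_sqrt) simp
  then have *: "(\<lambda>m. sqrt (enn2real (sqint M (u m)))) \<longlonglongrightarrow> 0" by simp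
  have "(\<lambda>m. expectation (\<lambda>\<omega>. norm (u m \<omega>))) \<longlonglongrightarrow> 0"
  proof (rule tendsto_sandwich[OF _ _ tendsto_const *])
    show "\<forall>\<^sub>F m in sequentially. 0 \<le> expectation (\<lambda>\<omega>. norm (u m \<omega>))"
      by (intro always_eventually allI integral_nonneg_AE) simp
    show "\<forall>\<^sub>F m in sequentially. expectation (\<lambda>\<omega>. norm (u m \<omega>)) \<le> sqrt (enn2real (sqint M (u m)))"
      using L1_le_sqint(2)[OF assms(1) fin] by (intro always_eventually allI) simp
  qed
  from tendsto_L1_AE_subseq[OF L1_le_sqint(1)[OF assms(1) fin] this] that
  show ?thesis by blast
qed

text \<open>For nonnegative \<open>y\<close>, add the quadratic Taylor bound for
  \<open>exp y\<close> to \<open>exp (- y) \<ge> 1 - y\<close>. Equality at 0 matters: it makes the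
  resulting moment bound vanish together with the variance.\<close>

lemma square_le_exp_sum: "y\<^sup>2 + 4 \<le> 2 * (exp y + exp (- y))" for y :: real
proof -
  have "y\<^sup>2 + 4 \<le> 2 * (exp y + exp (- y))" if "y \<ge> 0" for y :: real
    using exp_lower_Taylor_quadratic[OF that] exp_ge_add_one_self[of "- y"] by simp
  from this[of y] this[of "- y"] show ?thesis by (cases "y \<ge> 0") auto
qed

context brownian
begin

text \<open>\<open>is_wiener_integral\<close> at the horizon, with the partitions hidden in step
  pairs so that the closure properties of the latter carry over.\<close>

definition wiener :: "(real \<Rightarrow> real ^ 'n) \<Rightarrow> ('a \<Rightarrow> real) \<Rightarrow> bool" where
  "wiener f I \<longleftrightarrow> f \<in> borel_measurable (time_measure T) \<and> I \<in> borel_measurable M \<and>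
     (\<exists>g X. (\<forall>m. step_pair T B (g m) (X m)) \<and>
        (\<lambda>m. sqint (time_measure T) (\<lambda>s. f s - g m s)) \<longlonglongrightarrow> 0 \<and>
        (\<lambda>m. sqint M (\<lambda>\<omega>. I \<omega> - X m \<omega>)) \<longlonglongrightarrow> 0)"

lemma is_wiener_integral_iff_wiener: "is_wiener_integral M B T f I \<longleftrightarrow> wiener f I"
proof -
  have sq: "sqint (time_measure T) h = (\<integral>\<^sup>+s\<in>{0..T}. ennreal ((norm (h s))\<^sup>2) \<partial>lborel)" for h :: "real \<Rightarrow> real ^ 'n"
    unfolding sqint_def by (subst nn_integral_restrict_space) simp_all
  have sqM: "sqint M Y = (\<integral>\<^sup>+\<omega>. ennreal ((Y \<omega>)\<^sup>2) \<partial>M)" for Y :: "'a \<Rightarrow> real"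
    unfolding sqint_def by simp
  have meas: "set_borel_measurable lborel {0..T} f \<longleftrightarrow> f \<in> borel_measurable (time_measure T)"
    unfolding set_borel_measurable_def by (subst borel_measurable_restrict_space_iff) simp_all
  have "(\<exists>n p c. (\<forall>m. 0 \<le> p m 0 \<and> (\<forall>k<n m. p m k \<le> p m (Suc k)) \<and> p m (n m) \<le> T) \<and>
          (\<lambda>m. sqint (time_measure T) (\<lambda>s. f s - step_fun (n m) (p m) (c m) s)) \<longlonglongrightarrow> 0 \<and>
          (\<lambda>m. sqint M (\<lambda>\<omega>. I \<omega> - step_integral B (n m) (p m) (c m) \<omega>)) \<longlonglongrightarrow> 0)
     \<longleftrightarrow> (\<exists>g X. (\<forall>m. step_pair T B (g m) (X m)) \<and>
        (\<lambda>m. sqint (time_measure T) (\<lambda>s. f s - g m s)) \<longlonglongrightarrow> 0 \<and>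
        (\<lambda>m. sqint M (\<lambda>\<omega>. I \<omega> - X m \<omega>)) \<longlonglongrightarrow> 0)" (is "?L \<longleftrightarrow> ?R")
  proof
    assume ?L
    then obtain n p c where *: "\<forall>m. 0 \<le> p m 0 \<and> (\<forall>k<n m. p m k \<le> p m (Suc k)) \<and> p m (n m) \<le> T"
      "(\<lambda>m. sqint (time_measure T) (\<lambda>s. f s - step_fun (n m) (p m) (c m) s)) \<longlonglongrightarrow> 0"
      "(\<lambda>m. sqint M (\<lambda>\<omega>. I \<omega> - step_integral B (n m) (p m) (c m) \<omega>)) \<longlonglongrightarrow> 0" by blast
    then show ?R
      by (intro exI[of _ "\<lambda>m. step_fun (n m) (p m) (c m)"] exI[of _ "\<lambda>m. step_integral B (n m) (p m) (c m)"])
         (auto simp: step_pair_def)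
  next
    assume ?R
    then obtain g X where *: "\<forall>m. step_pair T B (g m) (X m)"
      "(\<lambda>m. sqint (time_measure T) (\<lambda>s. f s - g m s)) \<longlonglongrightarrow> 0"
      "(\<lambda>m. sqint M (\<lambda>\<omega>. I \<omega> - X m \<omega>)) \<longlonglongrightarrow> 0" by blast
    from *(1) obtain n p c where "\<forall>m. 0 \<le> p m 0 \<and> (\<forall>k<n m. p m k \<le> p m (Suc k)) \<and> p m (n m) \<le> T \<and>
       g m = step_fun (n m) (p m) (c m) \<and> X m = step_integral B (n m) (p m) (c m)"
      unfolding step_pair_def by metis
    with *(2,3) show ?L by (intro exI[of _ n] exI[of _ p] exI[of _ c]) auto
  qed
  then show ?thesis
    unfolding is_wiener_integral_def wiener_def sq sqM meas by blast
qed

lemma step_pair_measurable_time: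
  assumes "step_pair T B f X" shows "f \<in> borel_measurable (time_measure T)"
  using step_pair_measurable(1)[OF assms] by (intro measurable_restrict_space1) simp

text \<open>The Ito isometry holds with constant \<open>1\<close>. The constant \<open>4\<close> is what the exponential moment of
  \<open>X\<close>, normalised to unit variance, gives at once, and it suffices for all limits below.\<close>

lemma step_pair_second_moment:
  assumes "step_pair T B f X"
  shows "sqint M X \<le> 4 * sqint (time_measure T) f"
proof -
  let ?N = "time_measure T"
  define q where "q = enn2real (sqint ?N f)"
  have q: "sqint ?N f = ennreal q" "0 \<le> q"
    using step_pair_measurable(3)[OF assms] by (auto simp: q_def ennreal_enn2real_if)
  have [measurable]: "X \<in> borel_measurable M" "f \<in> borel_measurable ?N"
    using step_pair_measurable[OF assms] step_pair_measurable_time[OF assms] by auto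
  \<comment> \<open>The inequality for \<open>r * X\<close>, with the parameter \<open>r\<close>
    free; the constant 4 has been moved to the right-hand side.\<close>
  have main: "ennreal (r\<^sup>2) * sqint M X \<le> ennreal (4 * (exp (r\<^sup>2 * q / 2) - 1))" for r
  proof -
    have e: "(\<integral>\<^sup>+\<omega>. ennreal (exp (t * X \<omega>)) \<partial>M) = ennreal (exp (t\<^sup>2 * q / 2))" for t
      using step_pair_exp_moment[OF step_pair_scale[OF assms, of t]] q
      by (subst (asm) sqint_scale) (simp_all flip: ennreal_mult)
    have "ennreal (r\<^sup>2) * sqint M X + 4 = (\<integral>\<^sup>+\<omega>. ennreal ((r * X \<omega>)\<^sup>2 + 4) \<partial>M)"
      using sqint_scale[of X M r] by (simp add: sqint_def nn_integral_add emeasure_space_1)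
    also have "\<dots> \<le> (\<integral>\<^sup>+\<omega>. 2 * (ennreal (exp (r * X \<omega>)) + ennreal (exp ((- r) * X \<omega>))) \<partial>M)"
    proof (rule nn_integral_mono)
      fix \<omega>
      have "ennreal ((r * X \<omega>)\<^sup>2 + 4) \<le> ennreal (2 * (exp (r * X \<omega>) + exp (- (r * X \<omega>))))"
        by (intro ennreal_leI square_le_exp_sum)
      then show "ennreal ((r * X \<omega>)\<^sup>2 + 4) \<le> 2 * (ennreal (exp (r * X \<omega>)) + ennreal (exp ((- r) * X \<omega>)))"
        by (simp add: ennreal_mult)
    qed
    also have "\<dots> = ennreal (4 * exp (r\<^sup>2 * q / 2))"
    proof -
      have "(\<integral>\<^sup>+\<omega>. ennreal (exp (r * X \<omega>)) + ennreal (exp ((- r) * X \<omega>)) \<partial>M)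
          = ennreal (exp (r\<^sup>2 * q / 2)) + ennreal (exp ((- r)\<^sup>2 * q / 2))"
        unfolding e[symmetric] by (rule nn_integral_add) measurable
      also have "\<dots> = ennreal (2 * exp (r\<^sup>2 * q / 2))"
        by (simp flip: ennreal_plus)
      finally show ?thesis
        by (subst nn_integral_cmult) (simp_all flip: ennreal_mult ennreal_numeral)
    qed
    finally have le: "ennreal (r\<^sup>2) * sqint M X + 4 \<le> ennreal (4 * exp (r\<^sup>2 * q / 2))" .
    \<comment> \<open>The left-hand side is finite because the bound is, so the 4 can be subtracted
      among the reals.\<close>
    then obtain z where z: "ennreal (r\<^sup>2) * sqint M X = ennreal z" "0 \<le> z"
      by (cases "ennreal (r\<^sup>2) * sqint M X") (auto simp: top_unique)
    have "ennreal (z + 4) = ennreal z + 4" using z(2) by simp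
    then have "ennreal (z + 4) \<le> ennreal (4 * exp (r\<^sup>2 * q / 2))"
      using le unfolding z(1) by (rule ord_eq_le_trans)
    then have "z + 4 \<le> 4 * exp (r\<^sup>2 * q / 2)" by (subst (asm) ennreal_le_iff) simp_all
    then show ?thesis unfolding z(1) by (intro ennreal_leI) simp
  qed
  show ?thesis
  \<comment> \<open>A null integrand cannot be normalised, but then the bound in \<open>main\<close>
    is already zero.\<close>
  proof (cases "q = 0")
    case True
    then show ?thesis using main[of 1] by simp
  next
    case False
    then have "q > 0" using q by simp
    \<comment> \<open>Normalises to \<open>r\<^sup>2 * q = 1\<close>; the bound becomes
      \<open>4 * (exp (1/2) - 1)\<close>, which is at most 4.\<close>
    define r where "r = 1 / sqrt q"
    have r: "r\<^sup>2 = 1 / q" using \<open>q > 0\<close> by (simp add: r_def power_divide)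
    have "sqint M X = ennreal (q * r\<^sup>2) * sqint M X" using \<open>q > 0\<close> r by simp
    also have "\<dots> = ennreal q * (ennreal (r\<^sup>2) * sqint M X)"
      using q by (simp add: ennreal_mult mult.assoc)
    also have "\<dots> \<le> ennreal q * ennreal (4 * (exp (r\<^sup>2 * q / 2) - 1))"
      by (intro mult_left_mono main) simp
    also have "\<dots> \<le> ennreal q * ennreal 4"
      using exp_half_le2 r \<open>q > 0\<close> by (intro mult_left_mono ennreal_leI) auto
    also have "\<dots> = 4 * sqint ?N f" by (simp add: q mult.commute)
    finally show ?thesis .
  qed
qed

section \<open>Finiteness, linearity and null integrands of Wiener integrals\<close>

lemma wiener_finite:
  assumes "wiener f I"
  shows "sqint (time_measure T) f < \<infinity>" "sqint M I < \<infinity>"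
proof -
  let ?N = "time_measure T"
  from assms obtain g X where [measurable]: "f \<in> borel_measurable ?N" "I \<in> borel_measurable M"
    and sp: "\<And>m. step_pair T B (g m) (X m)"
    and lim: "(\<lambda>m. sqint ?N (\<lambda>s. f s - g m s)) \<longlonglongrightarrow> 0" "(\<lambda>m. sqint M (\<lambda>\<omega>. I \<omega> - X m \<omega>)) \<longlonglongrightarrow> 0"
    unfolding wiener_def by blast
  have [measurable]: "X m \<in> borel_measurable M" "g m \<in> borel_measurable ?N" for m
    using step_pair_measurable[OF sp] step_pair_measurable_time[OF sp] by auto
  have "eventually (\<lambda>m. sqint ?N (\<lambda>s. f s - g m s) < 1 \<and> sqint M (\<lambda>\<omega>. I \<omega> - X m \<omega>) < 1) sequentially"
    using lim by (intro eventually_conj order_tendstoD) auto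
  then obtain m where m: "sqint ?N (\<lambda>s. f s - g m s) < 1" "sqint M (\<lambda>\<omega>. I \<omega> - X m \<omega>) < 1"
    by (auto simp: eventually_sequentially)
  then have m': "sqint ?N (\<lambda>s. f s - g m s) < \<infinity>" "sqint M (\<lambda>\<omega>. I \<omega> - X m \<omega>) < \<infinity>"
    using less_trans by fastforce+
  have "sqint M (X m) < \<infinity>"
    using step_pair_second_moment[OF sp, of m] step_pair_measurable(3)[OF sp, of m]
    by (auto simp: ennreal_mult_less_top intro: le_less_trans)
  then show "sqint M I < \<infinity>"
    using sqint_add_finite[of "\<lambda>\<omega>. I \<omega> - X m \<omega>" M "X m"] m' by simp
  show "sqint ?N f < \<infinity>"
    using sqint_add_finite[of "\<lambda>s. f s - g m s" ?N "g m"] m' step_pair_measurable(3)[OF sp, of m] by simp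
qed

lemma wiener_add:
  assumes "wiener f I" "wiener g J"
  shows "wiener (\<lambda>s. f s + g s) (\<lambda>\<omega>. I \<omega> + J \<omega>)"
proof -
  let ?N = "time_measure T"
  from assms(1) obtain u X where [measurable]: "f \<in> borel_measurable ?N" "I \<in> borel_measurable M"
    and sp1: "\<And>m. step_pair T B (u m) (X m)"
    and lim1: "(\<lambda>m. sqint ?N (\<lambda>s. f s - u m s)) \<longlonglongrightarrow> 0" "(\<lambda>m. sqint M (\<lambda>\<omega>. I \<omega> - X m \<omega>)) \<longlonglongrightarrow> 0"
    unfolding wiener_def by blast
  from assms(2) obtain v Y where [measurable]: "g \<in> borel_measurable ?N" "J \<in> borel_measurable M"
    and sp2: "\<And>m. step_pair T B (v m) (Y m)"
    and lim2: "(\<lambda>m. sqint ?N (\<lambda>s. g s - v m s)) \<longlonglongrightarrow> 0" "(\<lambda>m. sqint M (\<lambda>\<omega>. J \<omega> - Y m \<omega>)) \<longlonglongrightarrow> 0"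
    unfolding wiener_def by blast
  have [measurable]: "X m \<in> borel_measurable M" "u m \<in> borel_measurable ?N"
     "Y m \<in> borel_measurable M" "v m \<in> borel_measurable ?N" for m
    using step_pair_measurable[OF sp1] step_pair_measurable_time[OF sp1]
      step_pair_measurable[OF sp2] step_pair_measurable_time[OF sp2] by auto
  have "step_pair T B (\<lambda>s. u m s + v m s) (\<lambda>\<omega>. X m \<omega> + Y m \<omega>)" for m
    using T_pos by (intro step_pair_add sp1 sp2) simp
  moreover have "(\<lambda>m. sqint ?N (\<lambda>s. (f s - u m s) + (g s - v m s))) \<longlonglongrightarrow> 0"
    by (rule sqint_tendsto_0_add[OF _ _ lim1(1) lim2(1)]) measurable
  moreover have "(\<lambda>m. sqint M (\<lambda>\<omega>. (I \<omega> - X m \<omega>) + (J \<omega> - Y m \<omega>))) \<longlonglongrightarrow> 0"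
    by (rule sqint_tendsto_0_add[OF _ _ lim1(2) lim2(2)]) measurable
  ultimately show ?thesis
    unfolding wiener_def
    by (intro conjI exI[of _ "\<lambda>m s. u m s + v m s"] exI[of _ "\<lambda>m \<omega>. X m \<omega> + Y m \<omega>"])
       (simp_all add: algebra_simps)
qed

lemma wiener_scale:
  assumes "wiener f I"
  shows "wiener (\<lambda>s. r *\<^sub>R f s) (\<lambda>\<omega>. r * I \<omega>)"
proof -
  let ?N = "time_measure T"
  from assms obtain u X where [measurable]: "f \<in> borel_measurable ?N" "I \<in> borel_measurable M"
    and sp: "\<And>m. step_pair T B (u m) (X m)"
    and lim: "(\<lambda>m. sqint ?N (\<lambda>s. f s - u m s)) \<longlonglongrightarrow> 0" "(\<lambda>m. sqint M (\<lambda>\<omega>. I \<omega> - X m \<omega>)) \<longlonglongrightarrow> 0"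
    unfolding wiener_def by blast
  have [measurable]: "X m \<in> borel_measurable M" "u m \<in> borel_measurable ?N" for m
    using step_pair_measurable[OF sp] step_pair_measurable_time[OF sp] by auto
  have eq: "sqint ?N (\<lambda>s. r *\<^sub>R f s - r *\<^sub>R u m s) = ennreal (r\<^sup>2) * sqint ?N (\<lambda>s. f s - u m s)"
    "sqint M (\<lambda>\<omega>. r * I \<omega> - r * X m \<omega>) = ennreal (r\<^sup>2) * sqint M (\<lambda>\<omega>. I \<omega> - X m \<omega>)" for m
    using sqint_scale[of "\<lambda>s. f s - u m s" ?N r] sqint_scale[of "\<lambda>\<omega>. I \<omega> - X m \<omega>" M r]
    by (simp_all add: algebra_simps)
  have "(\<lambda>m. ennreal (r\<^sup>2) * sqint ?N (\<lambda>s. f s - u m s)) \<longlonglongrightarrow> ennreal (r\<^sup>2) * 0"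
    "(\<lambda>m. ennreal (r\<^sup>2) * sqint M (\<lambda>\<omega>. I \<omega> - X m \<omega>)) \<longlonglongrightarrow> ennreal (r\<^sup>2) * 0"
    by (intro ennreal_tendsto_cmult lim; simp)+
  then show ?thesis
    unfolding wiener_def
    by (intro conjI exI[of _ "\<lambda>m s. r *\<^sub>R u m s"] exI[of _ "\<lambda>m \<omega>. r * X m \<omega>"])
       (simp_all add: eq step_pair_scale[OF sp])
qed

text \<open>If the integrand is null, its approximants tend to 0 in L^2, hence so do their integrals
  by the second-moment bound, and with them \<open>I\<close>. This identifies contracts almost
  surely when the kernel vanishes.\<close>

lemma wiener_null:
  assumes "wiener f I" and null: "sqint (time_measure T) f = 0"
  shows "AE \<omega> in M. I \<omega> = 0"
proof -
  let ?N = "time_measure T"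
  from assms(1) obtain u X where [measurable]: "f \<in> borel_measurable ?N" "I \<in> borel_measurable M"
    and sp: "\<And>m. step_pair T B (u m) (X m)"
    and lim: "(\<lambda>m. sqint ?N (\<lambda>s. f s - u m s)) \<longlonglongrightarrow> 0" "(\<lambda>m. sqint M (\<lambda>\<omega>. I \<omega> - X m \<omega>)) \<longlonglongrightarrow> 0"
    unfolding wiener_def by blast
  have [measurable]: "X m \<in> borel_measurable M" "u m \<in> borel_measurable ?N" for m
    using step_pair_measurable[OF sp] step_pair_measurable_time[OF sp] by auto
  have u: "sqint ?N (u m) \<le> 2 * sqint ?N (\<lambda>s. f s - u m s)" for m
    using sqint_add_le[of f ?N "\<lambda>s. u m s - f s" 1] null
    by (simp add: sqint_minus_commute[of ?N "u m"])
  \<comment> \<open>16 = 2 * 4 * 2: triangle inequality, second-moment bound, and triangle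
    inequality for the integrands.\<close>
  have "sqint M I \<le> 2 * sqint M (\<lambda>\<omega>. I \<omega> - X m \<omega>) + 16 * sqint ?N (\<lambda>s. f s - u m s)" for m
  proof -
    have "sqint M I \<le> 2 * sqint M (\<lambda>\<omega>. I \<omega> - X m \<omega>) + 2 * sqint M (X m)"
      using sqint_add_le[of "\<lambda>\<omega>. I \<omega> - X m \<omega>" M "X m" 1] by simp
    also have "2 * sqint M (X m) \<le> 2 * (4 * (2 * sqint ?N (\<lambda>s. f s - u m s)))"
      by (intro mult_left_mono order_trans[OF step_pair_second_moment[OF sp]] u) auto
    finally show ?thesis by (simp add: mult.assoc[symmetric] add_left_mono)
  qed
  moreover have "(\<lambda>m. 2 * sqint M (\<lambda>\<omega>. I \<omega> - X m \<omega>) + 16 * sqint ?N (\<lambda>s. f s - u m s)) \<longlonglongrightarrow> 2 * 0 + 16 * 0"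
    by (intro tendsto_add ennreal_tendsto_cmult lim) auto
  ultimately have "sqint M I \<le> 0"
    by (intro LIMSEQ_le_const) auto
  then have "AE \<omega> in M. ennreal ((norm (I \<omega>))\<^sup>2) = 0"
    unfolding sqint_def by (subst (asm) le_zero_eq, subst (asm) nn_integral_0_iff_AE) auto
  then show ?thesis by eventually_elim simp
qed

text \<open>Fatou's lemma along an almost surely convergent subsequence gives \<open>\<le>\<close>. For \<open>\<ge>\<close>, the tangent bound
  \<open>exp x \<ge> exp y * (1 + x - y)\<close> and Young's inequality absorb the error into the second exponential
  moments of the approximations, which stay bounded.\<close>

lemma wiener_exp_moment:
  assumes "wiener f I"
  defines "q \<equiv> enn2real (sqint (time_measure T) f)"
  shows "integrable M (\<lambda>\<omega>. exp (I \<omega>))" and "expectation (\<lambda>\<omega>. exp (I \<omega>)) = exp (q / 2)"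
proof -
  let ?N = "time_measure T"
  from assms(1) obtain u X where [measurable]: "f \<in> borel_measurable ?N" "I \<in> borel_measurable M"
    and sp: "\<And>m. step_pair T B (u m) (X m)"
    and lim: "(\<lambda>m. sqint ?N (\<lambda>s. f s - u m s)) \<longlonglongrightarrow> 0" "(\<lambda>m. sqint M (\<lambda>\<omega>. I \<omega> - X m \<omega>)) \<longlonglongrightarrow> 0"
    unfolding wiener_def by blast
  have [measurable]: "X m \<in> borel_measurable M" "u m \<in> borel_measurable ?N" for m
    using step_pair_measurable[OF sp] step_pair_measurable_time[OF sp] by auto
  define Q where "Q m = enn2real (sqint ?N (u m))" for m
  have Q: "Q \<longlonglongrightarrow> q"
    unfolding Q_def q_def by (intro tendsto_sqint lim wiener_finite[OF assms(1)]) auto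
  \<comment> \<open>Needed for \<open>t = 1\<close>, the moment itself, and for
    \<open>t = 2\<close>, the moment in the error term of the lower bound.\<close>
  have X_exp: "(\<integral>\<^sup>+\<omega>. ennreal (exp (t * X m \<omega>)) \<partial>M) = ennreal (exp (t\<^sup>2 * Q m / 2))" for t m
    using step_pair_exp_moment[OF step_pair_scale[OF sp, of t m]]
    by (subst (asm) sqint_scale) (simp_all add: Q_def enn2real_mult)
  have finX: "sqint M (X m) < \<infinity>" for m
    using step_pair_second_moment[OF sp, of m] step_pair_measurable(3)[OF sp, of m]
    by (auto simp: ennreal_mult_less_top intro: le_less_trans)
  have finIX: "sqint M (\<lambda>\<omega>. I \<omega> - X m \<omega>) < \<infinity>" for m
  proof -
    have "sqint M (\<lambda>\<omega>. (-1) *\<^sub>R X m \<omega>) < \<infinity>" using finX[of m] by (subst sqint_scale) auto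
    then show ?thesis
      using sqint_add_finite[of I M "\<lambda>\<omega>. (-1) *\<^sub>R X m \<omega>"] wiener_finite(2)[OF assms(1)] by simp
  qed
  obtain r :: "nat \<Rightarrow> nat" where r: "strict_mono r" "AE \<omega> in M. (\<lambda>m. I \<omega> - X (r m) \<omega>) \<longlonglongrightarrow> 0"
    using sqint_tendsto_0_AE_subseq[OF _ finIX lim(2)] by auto
  have "AE \<omega> in M. ennreal (exp (I \<omega>)) = liminf (\<lambda>m. ennreal (exp (X (r m) \<omega>)))"
    using r(2)
  proof eventually_elim
    case (elim \<omega>)
    have "(\<lambda>m. I \<omega> - (I \<omega> - X (r m) \<omega>)) \<longlonglongrightarrow> I \<omega> - 0" by (intro tendsto_diff tendsto_const elim)
    then have "(\<lambda>m. ennreal (exp (X (r m) \<omega>))) \<longlonglongrightarrow> ennreal (exp (I \<omega>))"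
      by (intro tendsto_ennrealI tendsto_exp) simp
    then show ?case by (intro lim_imp_Liminf[symmetric]) auto
  qed
  then have "(\<integral>\<^sup>+\<omega>. ennreal (exp (I \<omega>)) \<partial>M) = (\<integral>\<^sup>+\<omega>. liminf (\<lambda>m. ennreal (exp (X (r m) \<omega>))) \<partial>M)"
    by (rule nn_integral_cong_AE)
  also have "\<dots> \<le> liminf (\<lambda>m. \<integral>\<^sup>+\<omega>. ennreal (exp (X (r m) \<omega>)) \<partial>M)"
    by (intro nn_integral_liminf) auto
  also have "\<dots> = liminf (\<lambda>m. ennreal (exp (Q (r m) / 2)))"
    using X_exp[of 1] by simp
  also have "\<dots> = ennreal (exp (q / 2))"
  proof (rule lim_imp_Liminf)
    have "(\<lambda>m. Q (r m)) \<longlonglongrightarrow> q" using LIMSEQ_subseq_LIMSEQ[OF Q r(1)] by (simp add: o_def)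
    then show "(\<lambda>m. ennreal (exp (Q (r m) / 2))) \<longlonglongrightarrow> ennreal (exp (q / 2))"
      by (intro tendsto_ennrealI tendsto_exp tendsto_divide) auto
  qed simp
  finally have upper: "(\<integral>\<^sup>+\<omega>. ennreal (exp (I \<omega>)) \<partial>M) \<le> ennreal (exp (q / 2))" .
  then have "(\<integral>\<^sup>+\<omega>. ennreal (exp (I \<omega>)) \<partial>M) < \<infinity>"
    using ennreal_less_top le_less_trans by (metis infinity_ennreal_def)
  then show int: "integrable M (\<lambda>\<omega>. exp (I \<omega>))"
    by (intro integrableI_nonneg) auto
  define z where "z = expectation (\<lambda>\<omega>. exp (I \<omega>))"
  have z: "(\<integral>\<^sup>+\<omega>. ennreal (exp (I \<omega>)) \<partial>M) = ennreal z" "0 \<le> z"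
    unfolding z_def using int by (auto intro!: nn_integral_eq_integral)
  have "z \<le> exp (q / 2)" using upper unfolding z by simp
  moreover have "exp (q / 2) \<le> z"
  proof (rule field_le_epsilon)
    fix \<epsilon> :: real assume "\<epsilon> > 0"
    \<comment> \<open>The second exponential moment of \<open>X m\<close> is
      \<open>exp (2 * Q m)\<close>, with limit \<open>exp (2 * q)\<close>; weighted by \<delta> it
      leaves exactly \<epsilon>.\<close>
    define \<delta> where "\<delta> = \<epsilon> / exp (2 * q)"
    have \<delta>: "\<delta> > 0" "\<delta> * exp (2 * q) = \<epsilon>" using \<open>\<epsilon> > 0\<close> by (auto simp: \<delta>_def)
    define S where "S m = enn2real (sqint M (\<lambda>\<omega>. I \<omega> - X m \<omega>))" for m
    have S: "sqint M (\<lambda>\<omega>. I \<omega> - X m \<omega>) = ennreal (S m)" "0 \<le> S m" for m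
      unfolding S_def using finIX[of m] by (auto simp: ennreal_enn2real_if)
    have pw: "exp y \<le> exp x + (1 / \<delta> * (x - y)\<^sup>2 + \<delta> * exp (2 * y))" for x y :: real
    proof -
      have "exp y * (1 + (x - y)) \<le> exp y * exp (x - y)"
        by (intro mult_left_mono exp_ge_add_one_self) auto
      then have 1: "exp y \<le> exp x + (y - x) * exp y" by (simp add: algebra_simps flip: exp_add)
      have "0 \<le> ((y - x) - \<delta> * exp y)\<^sup>2 / \<delta>" using \<delta> by simp
      also have "\<dots> = 1 / \<delta> * (x - y)\<^sup>2 - 2 * ((y - x) * exp y) + \<delta> * (exp y)\<^sup>2"
        using \<delta>(1) by (simp add: field_simps power2_eq_square)
      finally have 2: "2 * ((y - x) * exp y) \<le> 1 / \<delta> * (x - y)\<^sup>2 + \<delta> * exp (2 * y)"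
        by (simp add: exp_double)
      have 3: "0 \<le> 1 / \<delta> * (x - y)\<^sup>2 + \<delta> * exp (2 * y)" using \<delta>(1) by simp
      show ?thesis using 1 2 3 by linarith
    qed
    have bound: "exp (Q m / 2) \<le> z + (1 / \<delta> * S m + \<delta> * exp (2 * Q m))" for m
    proof -
      have "ennreal (exp (Q m / 2)) = (\<integral>\<^sup>+\<omega>. ennreal (exp (X m \<omega>)) \<partial>M)"
        using X_exp[of 1 m] by simp
      also have "\<dots> \<le> (\<integral>\<^sup>+\<omega>. ennreal (exp (I \<omega>)) + (ennreal (1 / \<delta>) * ennreal ((norm (I \<omega> - X m \<omega>))\<^sup>2)
           + ennreal \<delta> * ennreal (exp (2 * X m \<omega>))) \<partial>M)"
      proof (rule nn_integral_mono)
        fix \<omega>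
        have "ennreal (exp (X m \<omega>)) \<le> ennreal (exp (I \<omega>) + (1 / \<delta> * (I \<omega> - X m \<omega>)\<^sup>2 + \<delta> * exp (2 * X m \<omega>)))"
          by (intro ennreal_leI pw)
        then show "ennreal (exp (X m \<omega>)) \<le> ennreal (exp (I \<omega>)) + (ennreal (1 / \<delta>) * ennreal ((norm (I \<omega> - X m \<omega>))\<^sup>2)
           + ennreal \<delta> * ennreal (exp (2 * X m \<omega>)))"
          using \<delta>(1) by (simp flip: ennreal_mult ennreal_plus)
      qed
      also have "\<dots> = (\<integral>\<^sup>+\<omega>. ennreal (exp (I \<omega>)) \<partial>M)
          + (ennreal (1 / \<delta>) * sqint M (\<lambda>\<omega>. I \<omega> - X m \<omega>)
            + ennreal \<delta> * (\<integral>\<^sup>+\<omega>. ennreal (exp (2 * X m \<omega>)) \<partial>M))"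
        unfolding sqint_def
        by (simp add: nn_integral_add nn_integral_cmult)
      also have "\<dots> = ennreal z + (ennreal (1 / \<delta>) * ennreal (S m) + ennreal \<delta> * ennreal (exp (2 * Q m)))"
        by (simp only: z S X_exp) simp
      also have "\<dots> = ennreal (z + (1 / \<delta> * S m + \<delta> * exp (2 * Q m)))"
        using \<delta>(1) z(2) S(2)[of m] by (simp flip: ennreal_mult ennreal_plus)
      finally show ?thesis
        using \<delta>(1) z(2) S(2)[of m] by (subst (asm) ennreal_le_iff) auto
    qed
    have S0: "S \<longlonglongrightarrow> 0"
      unfolding S_def using tendsto_enn2real[OF lim(2)[folded ennreal_0]] by simp
    have "exp (q / 2) \<le> z + (1 / \<delta> * 0 + \<delta> * exp (2 * q))"
    proof (rule LIMSEQ_le)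
      show "(\<lambda>m. exp (Q m / 2)) \<longlonglongrightarrow> exp (q / 2)" by (intro tendsto_intros Q) simp
      show "(\<lambda>m. z + (1 / \<delta> * S m + \<delta> * exp (2 * Q m))) \<longlonglongrightarrow> z + (1 / \<delta> * 0 + \<delta> * exp (2 * q))"
        by (intro tendsto_intros Q S0)
    qed (use bound in auto)
    then show "exp (q / 2) \<le> z + \<epsilon>" using \<delta>(2) by simp
  qed
  ultimately show "expectation (\<lambda>\<omega>. exp (I \<omega>)) = exp (q / 2)" unfolding z_def by simp
qed

end

subsection \<open>Density of step functions and existence of Wiener integrals\<close>

context brownian
begin

definition approximable :: "(real \<Rightarrow> real ^ 'n) \<Rightarrow> bool" where
  "approximable f \<longleftrightarrow> f \<in> borel_measurable (time_measure T) \<and>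
     (\<forall>\<epsilon>>0. \<exists>g X. step_pair T B g X \<and> sqint (time_measure T) (\<lambda>s. f s - g s) < \<epsilon>)"

text \<open>Triangle inequality for squared distances: the factor 2 on each of two terms explains
  the quarters.\<close>

lemma sqint_diff_less:
  fixes f g h :: "real \<Rightarrow> real ^ 'n"
  assumes [measurable]: "f \<in> borel_measurable N" "g \<in> borel_measurable N" "h \<in> borel_measurable N"
    and "sqint N (\<lambda>s. f s - g s) < \<epsilon> / 4" "sqint N (\<lambda>s. g s - h s) < \<epsilon> / 4"
  shows "sqint N (\<lambda>s. f s - h s) < \<epsilon>"
proof -
  have "sqint N (\<lambda>s. f s - h s) \<le> 2 * sqint N (\<lambda>s. f s - g s) + 2 * sqint N (\<lambda>s. g s - h s)"
    using sqint_add_le[of "\<lambda>s. f s - g s" N "\<lambda>s. g s - h s" 1] by simp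
  also have "\<dots> < 2 * (\<epsilon> / 4) + 2 * (\<epsilon> / 4)"
    using assms(4,5) by (intro add_strict_mono ennreal_mult_strict_left_mono) auto
  also have "\<dots> = \<epsilon>"
  proof -
    have "2 * (\<epsilon> / 4) + 2 * (\<epsilon> / 4) = (2 + 2) * (\<epsilon> / 4)" by (simp only: distrib_right)
    also have "\<dots> = 4 * \<epsilon> / 4" by (simp add: ennreal_times_divide)
    also have "\<dots> = \<epsilon>" by (simp add: ennreal_mult_divide_eq mult.commute)
    finally show ?thesis .
  qed
  finally show ?thesis .
qed

section \<open>Closure properties of the approximable functions\<close>

lemma approximable_step_pair: "step_pair T B g X \<Longrightarrow> approximable g"
  unfolding approximable_def using step_pair_measurable_time
  by (auto intro!: exI[of _ g] exI[of _ X] simp: sqint_def)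

lemma approximable_limit:
  assumes f[measurable]: "f \<in> borel_measurable (time_measure T)"
    and "\<And>m. approximable (h m)" and lim: "(\<lambda>m. sqint (time_measure T) (\<lambda>s. f s - h m s)) \<longlonglongrightarrow> 0"
  shows "approximable f"
  unfolding approximable_def
proof (intro conjI allI impI f)
  fix \<epsilon> :: ennreal assume "\<epsilon> > 0"
  then have \<epsilon>: "\<epsilon> / 4 > 0" by (simp add: ennreal_zero_less_divide)
  have [measurable]: "h m \<in> borel_measurable (time_measure T)" for m
    using assms(2) by (auto simp: approximable_def)
  obtain m where m: "sqint (time_measure T) (\<lambda>s. f s - h m s) < \<epsilon> / 4"
    using order_tendstoD(2)[OF lim \<epsilon>] by (auto simp: eventually_sequentially)
  obtain g X where gX: "step_pair T B g X" "sqint (time_measure T) (\<lambda>s. h m s - g s) < \<epsilon> / 4"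
    using assms(2)[of m] \<epsilon> unfolding approximable_def by blast
  have [measurable]: "g \<in> borel_measurable (time_measure T)" by (rule step_pair_measurable_time[OF gX(1)])
  have "sqint (time_measure T) (\<lambda>s. f s - g s) < \<epsilon>"
    by (rule sqint_diff_less[OF _ _ _ m gX(2)]) measurable
  with gX(1) show "\<exists>g X. step_pair T B g X \<and> sqint (time_measure T) (\<lambda>s. f s - g s) < \<epsilon>" by blast
qed

lemma approximable_add:
  assumes "approximable f" "approximable g"
  shows "approximable (\<lambda>s. f s + g s)"
  unfolding approximable_def
proof (intro conjI allI impI)
  let ?N = "time_measure T"
  have [measurable]: "f \<in> borel_measurable ?N" "g \<in> borel_measurable ?N"
    using assms by (auto simp: approximable_def)
  show "(\<lambda>s. f s + g s) \<in> borel_measurable ?N" by measurable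
  fix \<epsilon> :: ennreal assume "\<epsilon> > 0"
  then have \<epsilon>: "\<epsilon> / 4 > 0" by (simp add: ennreal_zero_less_divide)
  obtain u X where u: "step_pair T B u X" "sqint ?N (\<lambda>s. f s - u s) < \<epsilon> / 4"
    using assms(1) \<epsilon> unfolding approximable_def by blast
  obtain v Y where v: "step_pair T B v Y" "sqint ?N (\<lambda>s. g s - v s) < \<epsilon> / 4"
    using assms(2) \<epsilon> unfolding approximable_def by blast
  have [measurable]: "u \<in> borel_measurable ?N" "v \<in> borel_measurable ?N"
    using u v step_pair_measurable_time by auto
  have "sqint ?N (\<lambda>s. (f s + g s) - (u s + v s)) < \<epsilon>"
  proof (rule sqint_diff_less[of _ _ "\<lambda>s. u s + g s"])
    show "sqint ?N (\<lambda>s. f s + g s - (u s + g s)) < \<epsilon> / 4" using u(2) by simp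
    show "sqint ?N (\<lambda>s. u s + g s - (u s + v s)) < \<epsilon> / 4" using v(2) by simp
  qed measurable
  moreover have "step_pair T B (\<lambda>s. u s + v s) (\<lambda>\<omega>. X \<omega> + Y \<omega>)"
    using T_pos by (intro step_pair_add u v) simp
  ultimately show "\<exists>h X. step_pair T B h X \<and> sqint ?N (\<lambda>s. f s + g s - h s) < \<epsilon>" by blast
qed

lemma approximable_minus:
  assumes "approximable f"
  shows "approximable (\<lambda>s. - f s)"
  unfolding approximable_def
proof (intro conjI allI impI)
  have [measurable]: "f \<in> borel_measurable (time_measure T)"
    using assms by (auto simp: approximable_def)
  show "(\<lambda>s. - f s) \<in> borel_measurable (time_measure T)" by measurable
  fix \<epsilon> :: ennreal assume "\<epsilon> > 0"
  then obtain u X where u: "step_pair T B u X" "sqint (time_measure T) (\<lambda>s. f s - u s) < \<epsilon>"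
    using assms(1) unfolding approximable_def by blast
  have "sqint (time_measure T) (\<lambda>s. - f s - (-1) *\<^sub>R u s) = sqint (time_measure T) (\<lambda>s. f s - u s)"
    by (subst sqint_minus_commute) simp
  with u step_pair_scale[OF u(1), of "-1"]
  show "\<exists>h X. step_pair T B h X \<and> sqint (time_measure T) (\<lambda>s. - f s - h s) < \<epsilon>" by metis
qed

lemma approximable_0: "approximable (\<lambda>s. 0)"
proof -
  have "step_pair T B (step_fun 0 (\<lambda>_. 0) (\<lambda>_. 0)) (step_integral B 0 (\<lambda>_. 0) (\<lambda>_. 0))"
    unfolding step_pair_def using T_pos
    by (intro exI[of _ "0::nat"] exI[of _ "\<lambda>_. 0"]) simp
  from approximable_step_pair[OF this] show ?thesis by (simp add: step_fun_def[abs_def])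
qed

lemma approximable_sum:
  assumes "\<And>i. i \<in> S \<Longrightarrow> approximable (f i)"
  shows "approximable (\<lambda>s. \<Sum>i\<in>S. f i s)"
  using assms
  by (induction S rule: infinite_finite_induct) (auto intro: approximable_0 approximable_add)

text \<open>Dominated convergence turns pointwise limits into L^2 limits. It serves twice: for
  countable disjoint unions and for approximation by simple functions.\<close>

lemma approximable_dominated:
  assumes f[measurable]: "f \<in> borel_measurable (time_measure T)"
    and h: "\<And>m. approximable (h m)"
    and lim: "\<And>s. s \<in> {0..T} \<Longrightarrow> (\<lambda>m. h m s) \<longlonglongrightarrow> f s"
    and bound: "\<And>m s. s \<in> {0..T} \<Longrightarrow> norm (f s - h m s) \<le> w s"
    and w[measurable]: "w \<in> borel_measurable (time_measure T)"
    and fin: "(\<integral>\<^sup>+s. ennreal ((w s)\<^sup>2) \<partial>time_measure T) < \<infinity>"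
  shows "approximable f"
proof (rule approximable_limit[OF f h])
  have [measurable]: "h m \<in> borel_measurable (time_measure T)" for m
    using h by (auto simp: approximable_def)
  have "(\<lambda>m. \<integral>\<^sup>+s. ennreal ((norm (f s - h m s))\<^sup>2) \<partial>time_measure T) \<longlonglongrightarrow> (\<integral>\<^sup>+s. 0 \<partial>time_measure T)"
  proof (rule nn_integral_dominated_convergence[where w = "\<lambda>s. ennreal ((w s)\<^sup>2)"])
    show "AE s in time_measure T. ennreal ((norm (f s - h m s))\<^sup>2) \<le> ennreal ((w s)\<^sup>2)" for m
      using bound by (intro AE_I2 ennreal_leI power_mono) auto
    show "AE s in time_measure T. (\<lambda>m. ennreal ((norm (f s - h m s))\<^sup>2)) \<longlonglongrightarrow> 0"
    proof (rule AE_I2)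
      fix s assume "s \<in> space (time_measure T)"
      then have "(\<lambda>m. (norm (f s - h m s))\<^sup>2) \<longlonglongrightarrow> (norm (f s - f s))\<^sup>2"
        by (intro tendsto_intros lim) simp
      then have "(\<lambda>m. ennreal ((norm (f s - h m s))\<^sup>2)) \<longlonglongrightarrow> ennreal ((norm (f s - f s))\<^sup>2)"
        by (rule tendsto_ennrealI)
      then show "(\<lambda>m. ennreal ((norm (f s - h m s))\<^sup>2)) \<longlonglongrightarrow> 0" by simp
    qed
  qed (use fin in measurable)
  then show "(\<lambda>m. sqint (time_measure T) (\<lambda>s. f s - h m s)) \<longlonglongrightarrow> 0"
    unfolding sqint_def by simp
qed

text \<open>Dynkin's argument: the half-lines \<open>{..a}\<close> are stable under intersection and
  generate the Borel sets, and the sets with approximable indicator are closed under complements and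
  countable disjoint unions.\<close>

lemma approximable_indicator:
  assumes "A \<in> sets borel"
  shows "approximable (\<lambda>s. indicat_real A s *\<^sub>R c)"
proof -
  have time_const: "(\<integral>\<^sup>+s. ennreal (x\<^sup>2) \<partial>time_measure T) < \<infinity>" for x :: real
    using T_pos by (subst nn_integral_restrict_space) (simp_all add: nn_integral_cmult ennreal_mult_less_top)
  have bd: "norm (indicat_real A s *\<^sub>R c - indicat_real A' s *\<^sub>R c) \<le> norm c" for A A' s
    by (simp add: indicator_def)
  have meas [measurable]: "(\<lambda>s. indicat_real A s *\<^sub>R c) \<in> borel_measurable (time_measure T)"
    if "A \<in> sets borel" for A
    using that by (intro measurable_restrict_space1) simp
  have atMost: "approximable (\<lambda>s. indicat_real {..a} s *\<^sub>R c)" for a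
  proof (rule approximable_limit)
    \<comment> \<open>Clamping \<open>a\<close> to the time interval makes \<open>{0<..b}\<close>
      agree with the half-line on \<open>{0..T}\<close>, except possibly at the null point
      0.\<close>
    define b where "b = max 0 (min a T)"
    have b: "0 \<le> b" "b \<le> T" using T_pos by (auto simp: b_def)
    show "approximable (\<lambda>s. indicat_real {0<..b} s *\<^sub>R c)"
      using step_pair_single[OF b] approximable_step_pair by blast
    have "AE s in time_measure T. s \<noteq> 0"
      using AE_lborel_singleton[of "0::real"] by (subst AE_restrict_space_iff) (auto elim: eventually_mono)
    then have "AE s in time_measure T. ennreal ((norm (indicat_real {..a} s *\<^sub>R c - indicat_real {0<..b} s *\<^sub>R c))\<^sup>2) = 0"
    proof (rule AE_mp, intro AE_I2 impI)
      fix s :: real assume "s \<in> space (time_measure T)" "s \<noteq> 0"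
      then have "0 < s" "s \<le> T" by auto
      then have "s \<in> {..a} \<longleftrightarrow> s \<in> {0<..b}" unfolding b_def by auto
      then have "indicat_real {..a} s = indicat_real {0<..b} s" by (simp only: indicator_def)
      then show "ennreal ((norm (indicat_real {..a} s *\<^sub>R c - indicat_real {0<..b} s *\<^sub>R c))\<^sup>2) = 0" by simp
    qed
    then have "sqint (time_measure T) (\<lambda>s. indicat_real {..a} s *\<^sub>R c - indicat_real {0<..b} s *\<^sub>R c) = 0"
      unfolding sqint_def by (subst nn_integral_cong_AE) auto
    then show "(\<lambda>m. sqint (time_measure T) (\<lambda>s. indicat_real {..a} s *\<^sub>R c - indicat_real {0<..b} s *\<^sub>R c)) \<longlonglongrightarrow> 0"
      by simp
  qed (rule meas, simp)
  have UNIV: "approximable (\<lambda>s. indicat_real UNIV s *\<^sub>R c)"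
  proof (rule approximable_limit)
    show "approximable (\<lambda>s. indicat_real {..T} s *\<^sub>R c)" by (rule atMost)
    have "sqint (time_measure T) (\<lambda>s. indicat_real UNIV s *\<^sub>R c - indicat_real {..T} s *\<^sub>R c) = (\<integral>\<^sup>+s. 0 \<partial>time_measure T)"
      unfolding sqint_def by (intro nn_integral_cong) simp
    then show "(\<lambda>m. sqint (time_measure T) (\<lambda>s. indicat_real UNIV s *\<^sub>R c - indicat_real {..T} s *\<^sub>R c)) \<longlonglongrightarrow> 0"
      by simp
  qed (rule meas, simp)
  have "Int_stable (range (\<lambda>a::real. {..a}))"
    by (auto simp: Int_stable_def)
  moreover have "range (\<lambda>a::real. {..a}) \<subseteq> Pow UNIV" by simp
  moreover have "A \<in> sigma_sets UNIV (range (\<lambda>a::real. {..a}))"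
    using assms by (simp add: borel_eq_atMost)
  ultimately show ?thesis
  proof (induction rule: sigma_sets_induct_disjoint)
    case (basic A)
    then show ?case using atMost by auto
  next
    case empty
    then show ?case using approximable_0 by simp
  next
    case (compl A)
    have "approximable (\<lambda>s. indicat_real UNIV s *\<^sub>R c + - (indicat_real A s *\<^sub>R c))"
      by (intro approximable_add approximable_minus UNIV compl)
    moreover have "(\<lambda>s. indicat_real UNIV s *\<^sub>R c + - (indicat_real A s *\<^sub>R c)) = (\<lambda>s. indicat_real (UNIV - A) s *\<^sub>R c)"
      by (auto simp: fun_eq_iff indicator_def)
    ultimately show ?case by simp
  next
    case (union A)
    have borel: "A i \<in> sets borel" for i
      using union(2) by (auto simp: borel_eq_atMost)
    have ind: "indicat_real (\<Union>i<m. A i) s = (\<Sum>i<m. indicat_real (A i) s)" for m s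
      using union(1) by (intro indicator_UN_disjoint) (auto intro: disjoint_family_on_mono)
    show ?case
    proof (rule approximable_dominated)
      show "approximable (\<lambda>s. indicat_real (\<Union>i<m. A i) s *\<^sub>R c)" for m
        unfolding ind scaleR_sum_left by (intro approximable_sum union(3))
      show "(\<lambda>m. indicat_real (\<Union>i<m. A i) s *\<^sub>R c) \<longlonglongrightarrow> indicat_real (\<Union>i. A i) s *\<^sub>R c" for s
        by (intro tendsto_intros LIMSEQ_indicator_UN)
      show "norm (indicat_real (\<Union>i. A i) s *\<^sub>R c - indicat_real (\<Union>i<m. A i) s *\<^sub>R c) \<le> norm c" for s m
        by (rule bd)
      show "(\<lambda>s. indicat_real (\<Union>i. A i) s *\<^sub>R c) \<in> borel_measurable (time_measure T)"
        using borel by (intro meas) auto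
    qed (use time_const in auto)
  qed
qed

text \<open>Simple functions converge to \<open>f\<close> pointwise with norm at most twice that of
  \<open>f\<close>, so the difference is dominated by \<open>3 * norm (f s)\<close>.\<close>

lemma approximable_sq_integrable:
  assumes f[measurable]: "f \<in> borel_measurable (time_measure T)" and fin: "sqint (time_measure T) f < \<infinity>"
  shows "approximable f"
proof -
  let ?N = "time_measure T"
  obtain F where F: "\<And>i. simple_function ?N (F i)" "\<And>x. x \<in> space ?N \<Longrightarrow> (\<lambda>i. F i x) \<longlonglongrightarrow> f x"
    "\<And>i x. x \<in> space ?N \<Longrightarrow> dist (F i x) 0 \<le> 2 * dist (f x) 0"
    using borel_measurable_implies_sequence_metric[OF f, of 0] by blast
  have [measurable]: "F i \<in> borel_measurable ?N" for i
    using F(1) by (rule borel_measurable_simple_function)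
  \<comment> \<open>\<open>F i\<close> is simple only on the time interval; written out over its
    finitely many values it is a sum of indicators on the whole line.\<close>
  define h where "h i s = (\<Sum>y\<in>F i ` space ?N. indicat_real (F i -` {y} \<inter> space ?N) s *\<^sub>R y)" for i s
  have app: "approximable (h i)" for i
    unfolding h_def
  proof (intro approximable_sum approximable_indicator)
    fix y
    have "F i -` {y} \<inter> space ?N \<in> sets ?N" by (rule simple_functionD(2)[OF F(1)])
    then show "F i -` {y} \<inter> space ?N \<in> sets borel" by (auto simp: sets_restrict_space)
  qed
  have h: "h i s = F i s" if "s \<in> {0..T}" for i s
    unfolding h_def
    by (rule simple_function_indicator_representation_banach[OF F(1), symmetric]) (use that in simp)
  show ?thesis
  proof (rule approximable_dominated[where h = h and w = "\<lambda>s. 3 * norm (f s)"])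
    show "(\<lambda>m. h m s) \<longlonglongrightarrow> f s" if "s \<in> {0..T}" for s
      unfolding h[OF that] using F(2)[of s] that by simp
    show "norm (f s - h m s) \<le> 3 * norm (f s)" if "s \<in> {0..T}" for m s
      unfolding h[OF that] using F(3)[of s m] that norm_triangle_ineq4[of "f s" "F m s"] by simp
    have "(\<integral>\<^sup>+s. ennreal ((3 * norm (f s))\<^sup>2) \<partial>?N) = sqint ?N (\<lambda>s. 3 *\<^sub>R f s)"
      unfolding sqint_def by simp
    also have "\<dots> < \<infinity>" using fin by (subst sqint_scale) (simp_all add: ennreal_mult_less_top)
    finally show "(\<integral>\<^sup>+s. ennreal ((3 * norm (f s))\<^sup>2) \<partial>?N) < \<infinity>" .
  qed (use app in measurable)
qed

text \<open>The second-moment bound makes the step integrals Cauchy in L^2. As in the proof of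
  Riesz-Fischer, a subsequence converges almost surely, and Fatou's lemma shows that its limit is
  also the L^2 limit.\<close>

lemma wiener_exists:
  assumes f[measurable]: "f \<in> borel_measurable (time_measure T)" and fin: "sqint (time_measure T) f < \<infinity>"
  shows "\<exists>I. wiener f I"
proof -
  let ?N = "time_measure T"
  have "\<exists>g X. step_pair T B g X \<and> sqint ?N (\<lambda>s. f s - g s) < ennreal (inverse (real (Suc m)))" for m
    using approximable_sq_integrable[OF assms] unfolding approximable_def by auto
  then obtain g X where sp: "\<And>m. step_pair T B (g m) (X m)"
    and small: "\<And>m. sqint ?N (\<lambda>s. f s - g m s) < ennreal (inverse (real (Suc m)))" by metis
  have [measurable]: "X m \<in> borel_measurable M" "g m \<in> borel_measurable ?N" for m
    using step_pair_measurable[OF sp] step_pair_measurable_time[OF sp] by auto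
  define a where "a m = sqint ?N (\<lambda>s. f s - g m s)" for m
  have a0: "a \<longlonglongrightarrow> 0"
  proof (rule tendsto_sandwich[OF _ _ tendsto_const])
    show "(\<lambda>m. ennreal (inverse (real (Suc m)))) \<longlonglongrightarrow> 0"
      using tendsto_ennrealI[OF LIMSEQ_inverse_real_of_nat] by simp
    show "\<forall>\<^sub>F m in sequentially. a m \<le> ennreal (inverse (real (Suc m)))"
      unfolding a_def using small by (intro always_eventually allI less_imp_le)
  qed simp
  have dist: "sqint M (\<lambda>\<omega>. X i \<omega> - X j \<omega>) \<le> 8 * (a i + a j)" for i j
  proof -
    have "sqint M (\<lambda>\<omega>. X i \<omega> - X j \<omega>) \<le> 4 * sqint ?N (\<lambda>s. g i s - g j s)"
      using T_pos by (intro step_pair_second_moment step_pair_diff sp) simp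
    also have "sqint ?N (\<lambda>s. g i s - g j s) \<le> 2 * a i + 2 * a j"
      using sqint_add_le[of "\<lambda>s. g i s - f s" ?N "\<lambda>s. f s - g j s" 1]
      by (simp add: a_def sqint_minus_commute[of ?N "g i" f])
    finally show ?thesis by (simp add: mult_left_mono distrib_left mult.assoc[symmetric])
  qed
  have finX: "sqint M (X m) < \<infinity>" for m
    using step_pair_second_moment[OF sp, of m] step_pair_measurable(3)[OF sp, of m]
    by (auto simp: ennreal_mult_less_top intro: le_less_trans)
  have finXX: "sqint M (\<lambda>\<omega>. X i \<omega> - X j \<omega>) < \<infinity>" for i j
  proof -
    have "sqint M (\<lambda>\<omega>. (-1) *\<^sub>R X j \<omega>) < \<infinity>" using finX[of j] by (subst sqint_scale) auto
    then show ?thesis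
      using sqint_add_finite[of "X i" M "\<lambda>\<omega>. (-1) *\<^sub>R X j \<omega>"] finX[of i] by simp
  qed
  have cauchy: "\<exists>N. \<forall>i\<ge>N. \<forall>j\<ge>N. expectation (\<lambda>\<omega>. norm (X i \<omega> - X j \<omega>)) < e" if "e > 0" for e
  proof -
    \<comment> \<open>With each distance below \<open>d / 2\<close> the squared norm is at most
      \<open>8 * d\<close>, that is half of \<open>e\<^sup>2\<close>, which leaves a strict
      inequality.\<close>
    define d where "d = e\<^sup>2 / 16"
    have "d > 0" using that by (simp add: d_def)
    then have "eventually (\<lambda>m. a m < ennreal (d / 2)) sequentially"
      by (intro order_tendstoD(2)[OF a0]) simp
    then obtain N where N: "\<And>m. m \<ge> N \<Longrightarrow> a m < ennreal (d / 2)"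
      by (auto simp: eventually_sequentially)
    have "expectation (\<lambda>\<omega>. norm (X i \<omega> - X j \<omega>)) < e" if ij: "i \<ge> N" "j \<ge> N" for i j
    proof -
      have "sqint M (\<lambda>\<omega>. X i \<omega> - X j \<omega>) \<le> 8 * (ennreal (d / 2) + ennreal (d / 2))"
        by (intro order_trans[OF dist] mult_left_mono add_mono less_imp_le N ij) simp
      also have "\<dots> = ennreal (8 * d)"
      proof -
        have "ennreal (d / 2) + ennreal (d / 2) = ennreal d"
          using \<open>d > 0\<close> by (simp flip: ennreal_plus)
        then show ?thesis using \<open>d > 0\<close> by (simp add: ennreal_mult)
      qed
      finally have "enn2real (sqint M (\<lambda>\<omega>. X i \<omega> - X j \<omega>)) \<le> 8 * d"
        using \<open>d > 0\<close> by (intro enn2real_leI) auto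
      then have "sqrt (enn2real (sqint M (\<lambda>\<omega>. X i \<omega> - X j \<omega>))) \<le> sqrt (8 * d)" by simp
      also have "\<dots> < sqrt (e\<^sup>2)" using \<open>e > 0\<close> by (intro real_sqrt_less_mono) (simp add: d_def)
      also have "\<dots> = e" using \<open>e > 0\<close> by simp
      finally show ?thesis using L1_le_sqint(2)[OF _ finXX, of i j] by simp
    qed
    then show ?thesis by blast
  qed
  obtain r :: "nat \<Rightarrow> nat" where r: "strict_mono r" "AE \<omega> in M. Cauchy (\<lambda>m. X (r m) \<omega>)"
    using cauchy_L1_AE_cauchy_subseq[OF L1_le_sqint(1)[OF _ finX] cauchy] by auto
  \<comment> \<open>\<open>lim\<close> is total, so \<open>I\<close> is measurable as it stands; it
    is the limit of the subsequence almost surely.\<close>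
  define I where "I \<omega> = lim (\<lambda>m. X (r m) \<omega>)" for \<omega>
  have [measurable]: "I \<in> borel_measurable M" unfolding I_def by measurable
  have bound: "sqint M (\<lambda>\<omega>. I \<omega> - X (r m) \<omega>) \<le> 8 * a (r m)" for m
  proof -
    have "AE \<omega> in M. ennreal ((norm (I \<omega> - X (r m) \<omega>))\<^sup>2) = liminf (\<lambda>j. ennreal ((norm (X (r j) \<omega> - X (r m) \<omega>))\<^sup>2))"
      using r(2)
    proof eventually_elim
      case (elim \<omega>)
      then have "(\<lambda>j. X (r j) \<omega>) \<longlonglongrightarrow> I \<omega>"
        unfolding I_def by (simp add: Cauchy_convergent_iff convergent_LIMSEQ_iff)
      then have "(\<lambda>j. ennreal ((norm (X (r j) \<omega> - X (r m) \<omega>))\<^sup>2)) \<longlonglongrightarrow> ennreal ((norm (I \<omega> - X (r m) \<omega>))\<^sup>2)"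
        by (intro tendsto_ennrealI tendsto_intros)
      then show ?case by (intro lim_imp_Liminf[symmetric]) auto
    qed
    then have "sqint M (\<lambda>\<omega>. I \<omega> - X (r m) \<omega>) = (\<integral>\<^sup>+\<omega>. liminf (\<lambda>j. ennreal ((norm (X (r j) \<omega> - X (r m) \<omega>))\<^sup>2)) \<partial>M)"
      unfolding sqint_def by (rule nn_integral_cong_AE)
    also have "\<dots> \<le> liminf (\<lambda>j. sqint M (\<lambda>\<omega>. X (r j) \<omega> - X (r m) \<omega>))"
      unfolding sqint_def by (intro nn_integral_liminf) measurable
    also have "\<dots> \<le> liminf (\<lambda>j. 8 * (a (r j) + a (r m)))"
      by (intro Liminf_mono always_eventually allI dist)
    also have "\<dots> = 8 * (0 + a (r m))"
    proof (rule lim_imp_Liminf)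
      have "(\<lambda>j. a (r j)) \<longlonglongrightarrow> 0" using LIMSEQ_subseq_LIMSEQ[OF a0 r(1)] by (simp add: o_def)
      then show "(\<lambda>j. 8 * (a (r j) + a (r m))) \<longlonglongrightarrow> 8 * (0 + a (r m))"
        by (intro ennreal_tendsto_cmult tendsto_add tendsto_const) simp_all
    qed simp
    finally show ?thesis by simp
  qed
  have a1: "(\<lambda>m. a (r m)) \<longlonglongrightarrow> 0" using LIMSEQ_subseq_LIMSEQ[OF a0 r(1)] by (simp add: o_def)
  then have "(\<lambda>m. 8 * a (r m)) \<longlonglongrightarrow> 8 * 0" by (intro ennreal_tendsto_cmult) simp_all
  then have "(\<lambda>m. 8 * a (r m)) \<longlonglongrightarrow> 0" by simp
  then have "(\<lambda>m. sqint M (\<lambda>\<omega>. I \<omega> - X (r m) \<omega>)) \<longlonglongrightarrow> 0"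
    by (rule tendsto_sandwich[OF _ _ tendsto_const, rotated 2]) (use bound in \<open>auto intro: always_eventually\<close>)
  with a1 have "wiener f I"
    unfolding wiener_def a_def
    by (intro conjI exI[of _ "\<lambda>m. g (r m)"] exI[of _ "\<lambda>m. X (r m)"]) (simp_all add: sp)
  then show ?thesis by blast
qed

lemma wiener_wiener_integral:
  assumes "f \<in> borel_measurable (time_measure T)" "sqint (time_measure T) f < \<infinity>"
  shows "wiener f (wiener_integral M B T f)"
  using wiener_exists[OF assms] unfolding wiener_integral_def is_wiener_integral_iff_wiener
  by (rule someI_ex)

end

subsection \<open>The principal's problem\<close>

text \<open>Definiteness gives a trivial kernel, hence invertibility, without which
  \<open>matrix_inv\<close> would be an arbitrary choice. With w the image of \<open>x\<close> under
  the inverse, the form equals that of \<Gamma> at w.\<close>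

lemma sym_pos_def_inverse:
  fixes \<Gamma> :: "real ^ 'n ^ 'n"
  assumes "sym_pos_def \<Gamma>"
  shows "0 \<le> x \<bullet> (matrix_inv \<Gamma> *v x)"
proof -
  have "x = 0" if "\<Gamma> *v x = 0" for x
    using assms that unfolding sym_pos_def_def by (metis inner_zero_right less_irrefl)
  then have "invertible \<Gamma>"
    by (auto simp: invertible_left_inverse matrix_left_invertible_ker)
  then have "\<Gamma> ** matrix_inv \<Gamma> = mat 1"
    unfolding invertible_def matrix_inv_def by (rule someI2_ex) blast
  then have "\<Gamma> *v (matrix_inv \<Gamma> *v x) = x"
    by (simp add: matrix_vector_mul_assoc)
  then have "x \<bullet> (matrix_inv \<Gamma> *v x) = (matrix_inv \<Gamma> *v x) \<bullet> (\<Gamma> *v (matrix_inv \<Gamma> *v x))"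
    by (simp add: inner_commute)
  also have "\<dots> \<ge> 0"
    using assms unfolding sym_pos_def_def by (metis inner_zero_left less_imp_le order_refl)
  finally show ?thesis .
qed

lemma L2_inner_eq: "L2_inner T f g = (LINT s|time_measure T. f s \<bullet> g s)"
  unfolding L2_inner_def set_lebesgue_integral_def by (subst integral_restrict_space) simp_all

lemma (in brownian) principal_value_eq:
  fixes K :: "real \<Rightarrow> real \<Rightarrow> real ^ 'n" and \<Gamma> :: "real ^ 'n ^ 'n"
  assumes k[measurable]: "K T \<in> borel_measurable (time_measure T)"
    and fin: "sqint (time_measure T) (K T) < \<infinity>"
  defines "\<kappa> \<equiv> L2_inner T (K T) (K T)" and "G \<equiv> L2_inner T (K T) (\<lambda>s. matrix_inv \<Gamma> *v K T s)"
  shows "principal_value M B T g\<^sub>0 K \<Gamma> \<gamma>\<^sub>A \<gamma>\<^sub>P y b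
      = - exp (- \<gamma>\<^sub>P * (g\<^sub>0 T - y)
          + \<gamma>\<^sub>P / 2 * (b\<^sup>2 * ((\<gamma>\<^sub>A + \<gamma>\<^sub>P) * \<kappa> + G) - 2 * b * (\<gamma>\<^sub>P * \<kappa> + G) + \<gamma>\<^sub>P * \<kappa>))"
    and "L2_inner T (K T) (\<lambda>s. (c *\<^sub>R mat 1 + d *\<^sub>R matrix_inv \<Gamma>) *v K T s) = c * \<kappa> + d * G"
proof -
  let ?N = "time_measure T"
  define k where "k = K T"
  define P where "P = matrix_inv \<Gamma>"
  have [measurable]: "k \<in> borel_measurable ?N" using k by (simp add: k_def)
  have lin: "A *v (r *\<^sub>R x) = r *\<^sub>R (A *v x)" for A :: "real ^ 'n ^ 'n" and r x
    by (rule matrix_vector_mult_scaleR)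
  have Pm [measurable]: "(\<lambda>x. P *v x) \<in> borel_measurable borel"
    by (intro borel_measurable_continuous_onI matrix_vector_mult_linear_continuous_on)
  have Pk [measurable]: "(\<lambda>s. P *v k s) \<in> borel_measurable ?N"
    by (rule measurable_compose[OF _ Pm]) measurable
  have kk: "integrable ?N (\<lambda>s. k s \<bullet> k s)"
    using fin unfolding sqint_def power2_norm_eq_inner k_def by (intro integrableI_nonneg) auto
  \<comment> \<open>The operator bound makes the effort square-integrable, and with Cauchy-Schwarz
    also its product with the kernel.\<close>
  obtain C where C: "\<And>x. norm (P *v x) \<le> norm x * C"
    using bounded_linear.bounded[OF matrix_vector_mul_bounded_linear[of P]] by blast
  have PP: "integrable ?N (\<lambda>s. (P *v k s) \<bullet> (P *v k s))"
  proof (rule Bochner_Integration.integrable_bound)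
    show "integrable ?N (\<lambda>s. C\<^sup>2 * (k s \<bullet> k s))" using kk by simp
    show "AE s in ?N. norm ((P *v k s) \<bullet> (P *v k s)) \<le> norm (C\<^sup>2 * (k s \<bullet> k s))"
    proof (intro AE_I2)
      fix s
      have "(norm (P *v k s))\<^sup>2 \<le> (norm (k s) * C)\<^sup>2"
        by (rule power_mono[OF C norm_ge_zero])
      then show "norm ((P *v k s) \<bullet> (P *v k s)) \<le> norm (C\<^sup>2 * (k s \<bullet> k s))"
        by (simp add: power_mult_distrib mult.commute flip: power2_norm_eq_inner)
    qed
  qed measurable
  have kP: "integrable ?N (\<lambda>s. k s \<bullet> (P *v k s))"
  proof (rule Bochner_Integration.integrable_bound)
    show "integrable ?N (\<lambda>s. (k s \<bullet> k s) + (P *v k s) \<bullet> (P *v k s))" using kk PP by simp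
    show "AE s in ?N. norm (k s \<bullet> (P *v k s)) \<le> norm ((k s \<bullet> k s) + (P *v k s) \<bullet> (P *v k s))"
    proof (intro AE_I2)
      fix s
      have "\<bar>k s \<bullet> (P *v k s)\<bar> \<le> norm (k s) * norm (P *v k s)" by (rule Cauchy_Schwarz_ineq2)
      also have "\<dots> \<le> (norm (k s))\<^sup>2 + (norm (P *v k s))\<^sup>2"
        using sum_squares_bound[of "norm (k s)" "norm (P *v k s)"]
          mult_nonneg_nonneg[OF norm_ge_zero[of "k s"] norm_ge_zero[of "P *v k s"]] by linarith
      finally show "norm (k s \<bullet> (P *v k s)) \<le> norm ((k s \<bullet> k s) + (P *v k s) \<bullet> (P *v k s))"
        by (simp add: power2_norm_eq_inner)
    qed
  qed measurable
  \<comment> \<open>Up to the factor \<open>b\<^sup>2\<close>, the squared norm of the effort. It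
    enters through the Girsanov density and through the exponential moment, and cancels in the last
    step.\<close>
  define H where "H = (LINT s|?N. (P *v k s) \<bullet> (P *v k s))"
  have \<kappa>: "\<kappa> = (LINT s|?N. k s \<bullet> k s)" unfolding \<kappa>_def L2_inner_eq k_def ..
  have G: "G = (LINT s|?N. k s \<bullet> (P *v k s))" unfolding G_def L2_inner_eq k_def P_def ..
  have "L2_inner T (K T) (\<lambda>s. (c *\<^sub>R mat 1 + d *\<^sub>R matrix_inv \<Gamma>) *v K T s)
     = (LINT s|?N. c * (k s \<bullet> k s) + d * (k s \<bullet> (P *v k s)))"
    unfolding L2_inner_eq k_def[symmetric] P_def[symmetric]
    by (simp add: matrix_vector_mult_add_rdistrib inner_add_right flip: scaleR_matrix_vector_assoc)
  then show "L2_inner T (K T) (\<lambda>s. (c *\<^sub>R mat 1 + d *\<^sub>R matrix_inv \<Gamma>) *v K T s) = c * \<kappa> + d * G"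
    using kk kP by (simp add: \<kappa> G)
  have fstar: "(LINT s:{0..T}|lborel. f_star \<gamma>\<^sub>A \<Gamma> (b *\<^sub>R K T s)) = b\<^sup>2 / 2 * (\<gamma>\<^sub>A * \<kappa> - G)"
  proof -
    have f: "f_star \<gamma>\<^sub>A \<Gamma> (b *\<^sub>R x) = b\<^sup>2 / 2 * (\<gamma>\<^sub>A * (x \<bullet> x) - x \<bullet> (P *v x))" for x
      unfolding f_star_def P_def[symmetric]
      by (simp add: lin matrix_vector_mult_diff_rdistrib inner_diff_right power2_eq_square algebra_simps
            flip: scaleR_matrix_vector_assoc)
    have "(LINT s:{0..T}|lborel. f_star \<gamma>\<^sub>A \<Gamma> (b *\<^sub>R K T s))
        = (LINT s|?N. b\<^sup>2 / 2 * (\<gamma>\<^sub>A * (k s \<bullet> k s) - k s \<bullet> (P *v k s)))"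
      unfolding f set_lebesgue_integral_def k_def by (subst integral_restrict_space) simp_all
    also have "\<dots> = b\<^sup>2 / 2 * (\<gamma>\<^sub>A * \<kappa> - G)"
      using kk kP by (simp add: \<kappa> G)
    finally show ?thesis .
  qed
  have reply: "best_reply T K \<Gamma> b = (\<lambda>s. b *\<^sub>R (P *v k s))"
    by (simp add: fun_eq_iff best_reply_def k_def P_def lin)
  have cost: "(LINT s:{0..T}|lborel. (norm (best_reply T K \<Gamma> b s))\<^sup>2) = b\<^sup>2 * H"
  proof -
    have "(LINT s:{0..T}|lborel. (norm (best_reply T K \<Gamma> b s))\<^sup>2) = (LINT s|?N. (norm (best_reply T K \<Gamma> b s))\<^sup>2)"
      unfolding set_lebesgue_integral_def by (subst integral_restrict_space) simp_all
    also have "\<dots> = (LINT s|?N. b\<^sup>2 * ((P *v k s) \<bullet> (P *v k s)))"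
      by (simp add: reply power_mult_distrib power2_norm_eq_inner)
    finally show ?thesis by (simp add: H_def)
  qed
  have sq: "enn2real (sqint ?N f) = (LINT s|?N. f s \<bullet> f s)" if [measurable]: "f \<in> borel_measurable ?N"
    for f :: "real \<Rightarrow> real ^ 'n"
    unfolding sqint_def power2_norm_eq_inner by (subst integral_eq_nn_integral) auto
  define I where "I = wiener_integral M B T (K T)"
  define J where "J = wiener_integral M B T (best_reply T K \<Gamma> b)"
  have wI: "wiener k I" unfolding I_def k_def by (rule wiener_wiener_integral[OF k fin])
  have wJ: "wiener (\<lambda>s. b *\<^sub>R (P *v k s)) J" unfolding J_def reply
  proof (rule wiener_wiener_integral)
    have "integrable ?N (\<lambda>s. b\<^sup>2 * ((P *v k s) \<bullet> (P *v k s)))" using PP by simp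
    then show "sqint ?N (\<lambda>s. b *\<^sub>R (P *v k s)) < \<infinity>"
      unfolding sqint_def integrable_iff_bounded by (simp add: power_mult_distrib power2_norm_eq_inner)
  qed measurable
  have [measurable]: "I \<in> borel_measurable M" "J \<in> borel_measurable M"
    using wI wJ by (auto simp: wiener_def)
  \<comment> \<open>The net exposure of the principal: output has slope 1, the contract takes
    \<open>b\<close> of it, and utility multiplies by \<open>- \<gamma>\<^sub>P\<close>.\<close>
  define r where "r = - \<gamma>\<^sub>P * (1 - b)"
  have w: "wiener (\<lambda>s. b *\<^sub>R (P *v k s) + r *\<^sub>R k s) (\<lambda>\<omega>. J \<omega> + r * I \<omega>)"
    by (intro wiener_add wJ wiener_scale wI)
  have q: "enn2real (sqint ?N (\<lambda>s. b *\<^sub>R (P *v k s) + r *\<^sub>R k s)) = b\<^sup>2 * H + 2 * b * r * G + r\<^sup>2 * \<kappa>"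
  proof -
    have "enn2real (sqint ?N (\<lambda>s. b *\<^sub>R (P *v k s) + r *\<^sub>R k s))
      = (LINT s|?N. b\<^sup>2 * ((P *v k s) \<bullet> (P *v k s)) + 2 * b * r * (k s \<bullet> (P *v k s)) + r\<^sup>2 * (k s \<bullet> k s))"
      by (subst sq) (auto simp: inner_add_left inner_add_right power2_eq_square inner_commute algebra_simps
          intro!: Bochner_Integration.integral_cong)
    also have "\<dots> = b\<^sup>2 * H + 2 * b * r * G + r\<^sup>2 * \<kappa>"
      using kk kP PP by (simp add: H_def G \<kappa>)
    finally show ?thesis .
  qed
  have E: "expectation (\<lambda>\<omega>. exp (J \<omega> + r * I \<omega>)) = exp ((b\<^sup>2 * H + 2 * b * r * G + r\<^sup>2 * \<kappa>) / 2)"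
    using wiener_exp_moment(2)[OF w] unfolding q .
  define e where "e = - (b\<^sup>2 * H / 2) - \<gamma>\<^sub>P * (g\<^sub>0 T - y - b\<^sup>2 / 2 * (\<gamma>\<^sub>A * \<kappa> - G))"
  have pay: "principal_payoff M B T g\<^sub>0 K \<Gamma> \<gamma>\<^sub>A \<gamma>\<^sub>P y b
      = (\<lambda>\<omega>. - exp (- \<gamma>\<^sub>P * (g\<^sub>0 T - y - b\<^sup>2 / 2 * (\<gamma>\<^sub>A * \<kappa> - G)) + r * I \<omega>))"
    unfolding principal_payoff_def cara_def agg_output_def linear_contract_def fstar I_def[symmetric] r_def
    by (simp add: fun_eq_iff algebra_simps)
  have "principal_value M B T g\<^sub>0 K \<Gamma> \<gamma>\<^sub>A \<gamma>\<^sub>P y b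
      = expectation (\<lambda>\<omega>. exp (J \<omega> - 1 / 2 * (b\<^sup>2 * H)) *\<^sub>R
          - exp (- \<gamma>\<^sub>P * (g\<^sub>0 T - y - b\<^sup>2 / 2 * (\<gamma>\<^sub>A * \<kappa> - G)) + r * I \<omega>))"
    unfolding principal_value_def reply_measure_def effort_measure_def pay cost J_def[symmetric]
    by (subst integral_density) auto
  also have "\<dots> = expectation (\<lambda>\<omega>. - exp e * exp (J \<omega> + r * I \<omega>))"
  proof (intro Bochner_Integration.integral_cong refl)
    fix \<omega>
    have "(J \<omega> - 1 / 2 * (b\<^sup>2 * H)) + (- \<gamma>\<^sub>P * (g\<^sub>0 T - y - b\<^sup>2 / 2 * (\<gamma>\<^sub>A * \<kappa> - G)) + r * I \<omega>)
        = e + (J \<omega> + r * I \<omega>)" by (simp add: e_def)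
    then show "exp (J \<omega> - 1 / 2 * (b\<^sup>2 * H)) *\<^sub>R
          - exp (- \<gamma>\<^sub>P * (g\<^sub>0 T - y - b\<^sup>2 / 2 * (\<gamma>\<^sub>A * \<kappa> - G)) + r * I \<omega>) = - exp e * exp (J \<omega> + r * I \<omega>)"
      by (simp only: real_scaleR_def mult_minus_right mult_minus_left flip: exp_add)
  qed
  also have "\<dots> = - exp (e + (b\<^sup>2 * H + 2 * b * r * G + r\<^sup>2 * \<kappa>) / 2)"
    by (simp only: integral_mult_right_zero E mult_minus_left integral_minus exp_add[of e])
  also have "e + (b\<^sup>2 * H + 2 * b * r * G + r\<^sup>2 * \<kappa>) / 2 = - \<gamma>\<^sub>P * (g\<^sub>0 T - y)
          + \<gamma>\<^sub>P / 2 * (b\<^sup>2 * ((\<gamma>\<^sub>A + \<gamma>\<^sub>P) * \<kappa> + G) - 2 * b * (\<gamma>\<^sub>P * \<kappa> + G) + \<gamma>\<^sub>P * \<kappa>)"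
    unfolding e_def r_def by (simp add: field_simps power2_eq_square)
  finally show "principal_value M B T g\<^sub>0 K \<Gamma> \<gamma>\<^sub>A \<gamma>\<^sub>P y b
      = - exp (- \<gamma>\<^sub>P * (g\<^sub>0 T - y)
          + \<gamma>\<^sub>P / 2 * (b\<^sup>2 * ((\<gamma>\<^sub>A + \<gamma>\<^sub>P) * \<kappa> + G) - 2 * b * (\<gamma>\<^sub>P * \<kappa> + G) + \<gamma>\<^sub>P * \<kappa>))" .
qed

lemma volterra_kernel_slice:
  assumes "0 < T" "volterra_kernel T K"
  shows "K T \<in> borel_measurable (time_measure T)" "sqint (time_measure T) (K T) < \<infinity>"
proof -
  have "(\<lambda>s. (T, s)) \<in> borel_measurable (time_measure T)"
    by (intro measurable_restrict_space1) (simp add: borel_measurable_continuous_onI continuous_on_Pair)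
  then have "(\<lambda>s. (T, s)) \<in> measurable (time_measure T) (restrict_space borel ({0..T} \<times> {0..T}))"
    using assms(1) by (intro measurable_restrict_space2) auto
  moreover have "(\<lambda>(t, s). K t s) \<in> borel_measurable (restrict_space borel ({0..T} \<times> {0..T}))"
    using assms(2) by (simp only: volterra_kernel_def)
  ultimately have "(\<lambda>s. case (T, s) of (t, s) \<Rightarrow> K t s) \<in> borel_measurable (time_measure T)"
    by (rule measurable_compose)
  then show "K T \<in> borel_measurable (time_measure T)" by simp
  have "sqint (time_measure T) (K T) = (\<integral>\<^sup>+s\<in>{0..T}. ennreal ((norm (K T s))\<^sup>2) \<partial>lborel)"
    unfolding sqint_def by (subst nn_integral_restrict_space) simp_all
  also have "\<dots> \<le> (SUP t\<in>{0..T}. \<integral>\<^sup>+s\<in>{0..T}. ennreal ((norm (K t s))\<^sup>2) \<partial>lborel)"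
    using assms(1) by (intro SUP_upper) simp
  also have "\<dots> < \<infinity>" using assms(2) by (simp add: volterra_kernel_def)
  finally show "sqint (time_measure T) (K T) < \<infinity>" .
qed

lemma arg_max_reals_iff: "is_arg_max f P x \<longleftrightarrow> P x \<and> (\<forall>y. P y \<longrightarrow> f y \<le> (f x :: real))"
  by (auto simp: is_arg_max_def not_less)

text \<open>The vertex is given by a product, not a quotient, so that the degenerate case where
  \<open>D\<close> and \<open>N\<close> both vanish is included.\<close>

lemma quadratic_completed_square:
  fixes D N b m :: real
  assumes "m * D = N"
  shows "b\<^sup>2 * D - 2 * b * N = D * (b - m)\<^sup>2 - m * N"
  unfolding assms[symmetric] by (simp add: power2_eq_square algebra_simps)

theorem theorem5p3:
  fixes M :: "'a measure" and F :: "real \<Rightarrow> 'a measure"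
    and B :: "real \<Rightarrow> 'a \<Rightarrow> real ^ 'n"
    and T \<gamma>\<^sub>A \<gamma>\<^sub>P y\<^sub>0 :: real
    and g\<^sub>0 :: "real \<Rightarrow> real" and K :: "real \<Rightarrow> real \<Rightarrow> real ^ 'n"
    and \<Gamma> :: "real ^ 'n ^ 'n"
    and bs \<chi>\<^sub>0 :: real and \<beta>s :: "real \<Rightarrow> real ^ 'n" and \<xi>s :: "'a \<Rightarrow> real"
  assumes "T > 0"
    and "prob_space M"
    and "filtration_on M T F"
    and "brownian_motion M T F B"
    and "g\<^sub>0 \<in> borel_measurable (restrict_space borel {0..T})"
    and "volterra_kernel T K"
    and "\<gamma>\<^sub>A > 0" and "\<gamma>\<^sub>P > 0"
    and "sym_pos_def \<Gamma>"
    and b_star: "bs = L2_inner T (K T) (\<lambda>s. (\<gamma>\<^sub>P *\<^sub>R mat 1 + matrix_inv \<Gamma>) *v K T s)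
                    / L2_inner T (K T) (\<lambda>s. ((\<gamma>\<^sub>A + \<gamma>\<^sub>P) *\<^sub>R mat 1 + matrix_inv \<Gamma>) *v K T s)"
    and beta_star: "\<And>t. \<beta>s t = bs *\<^sub>R K T t"
    and chi_0: "\<chi>\<^sub>0 = \<gamma>\<^sub>P / 2 * L2_inner T (K T)
          (\<lambda>s. (\<gamma>\<^sub>P *\<^sub>R mat 1 - bs *\<^sub>R (\<gamma>\<^sub>P *\<^sub>R mat 1 + matrix_inv \<Gamma>)) *v K T s)"
    and xi_star: "\<And>\<omega>. \<xi>s \<omega> = y\<^sub>0 - bs * g\<^sub>0 T
          + (LINT s:{0..T}|lborel. f_star \<gamma>\<^sub>A \<Gamma> (\<beta>s s)) + bs * agg_output M B g\<^sub>0 K T \<omega>"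
  shows
    "(\<forall>y\<ge>y\<^sub>0.
        is_arg_max (principal_value M B T g\<^sub>0 K \<Gamma> \<gamma>\<^sub>A \<gamma>\<^sub>P y) (\<lambda>b. True) bs \<and>
        (\<forall>t\<in>{0..T}. best_reply T K \<Gamma> bs t = matrix_inv \<Gamma> *v \<beta>s t) \<and>
        (\<forall>b. is_arg_max (principal_value M B T g\<^sub>0 K \<Gamma> \<gamma>\<^sub>A \<gamma>\<^sub>P y) (\<lambda>b. True) b \<longrightarrow>
           (AE t in lborel. t \<in> {0..T} \<longrightarrow> best_reply T K \<Gamma> b t = matrix_inv \<Gamma> *v \<beta>s t))) \<and>
     (\<forall>y\<ge>y\<^sub>0. V_lin M B T g\<^sub>0 K \<Gamma> \<gamma>\<^sub>A \<gamma>\<^sub>P y = - exp (- \<gamma>\<^sub>P * (g\<^sub>0 T - y) + \<chi>\<^sub>0)) \<and>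
     (SUP y\<in>{y\<^sub>0..}. V_lin M B T g\<^sub>0 K \<Gamma> \<gamma>\<^sub>A \<gamma>\<^sub>P y) = V_lin M B T g\<^sub>0 K \<Gamma> \<gamma>\<^sub>A \<gamma>\<^sub>P y\<^sub>0 \<and>
     is_arg_max (\<lambda>(y, b). principal_value M B T g\<^sub>0 K \<Gamma> \<gamma>\<^sub>A \<gamma>\<^sub>P y b) (\<lambda>(y, b). y \<ge> y\<^sub>0) (y\<^sub>0, bs) \<and>
     (AE \<omega> in M. linear_contract M B T K \<Gamma> \<gamma>\<^sub>A y\<^sub>0 bs \<omega> = \<xi>s \<omega>) \<and>
     (\<forall>y b. is_arg_max (\<lambda>(y, b). principal_value M B T g\<^sub>0 K \<Gamma> \<gamma>\<^sub>A \<gamma>\<^sub>P y b) (\<lambda>(y, b). y \<ge> y\<^sub>0) (y, b) \<longrightarrow>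
        (AE \<omega> in M. linear_contract M B T K \<Gamma> \<gamma>\<^sub>A y b \<omega> = \<xi>s \<omega>))"
proof -
  interpret prob_space M by fact
  interpret brownian M T F B
    using assms(1,3,4) by unfold_locales
  note k = volterra_kernel_slice[OF assms(1,6)]
  note k(1)[measurable]
  define \<kappa> where "\<kappa> = L2_inner T (K T) (K T)"
  define G where "G = L2_inner T (K T) (\<lambda>s. matrix_inv \<Gamma> *v K T s)"
  define D where "D = (\<gamma>\<^sub>A + \<gamma>\<^sub>P) * \<kappa> + G"
  define N where "N = \<gamma>\<^sub>P * \<kappa> + G"
  note lin = principal_value_eq(2)[where K = K and \<Gamma> = \<Gamma>, OF k, folded \<kappa>_def G_def]
  have "0 \<le> \<kappa>" unfolding \<kappa>_def L2_inner_eq by (intro integral_nonneg_AE) simp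
  have "0 \<le> G" unfolding G_def L2_inner_eq
    using sym_pos_def_inverse[OF assms(9)] by (intro integral_nonneg_AE) simp
  have \<kappa>_sq: "\<kappa> = enn2real (sqint (time_measure T) (K T))"
    unfolding \<kappa>_def L2_inner_eq sqint_def power2_norm_eq_inner by (subst integral_eq_nn_integral) auto
  \<comment> \<open>Finiteness matters here, since \<open>enn2real\<close> also sends infinity to
    0.\<close>
  have null: "sqint (time_measure T) (K T) = 0" if "\<kappa> = 0"
    using that k(2) unfolding \<kappa>_sq by (auto simp: enn2real_eq_0_iff)
  have null_AE: "AE s in time_measure T. K T s = 0" if "\<kappa> = 0"
  proof -
    have "AE s in time_measure T. ennreal ((norm (K T s))\<^sup>2) = 0"
      using null[OF that] unfolding sqint_def by (subst (asm) nn_integral_0_iff_AE) auto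
    then show ?thesis by eventually_elim simp
  qed
  have null_G: "G = 0" if "\<kappa> = 0"
  proof -
    have "G = (LINT s|time_measure T. 0)"
      unfolding G_def L2_inner_eq
    proof (rule integral_cong_AE)
      show "AE s in time_measure T. K T s \<bullet> (matrix_inv \<Gamma> *v K T s) = 0"
        using null_AE[OF that] by eventually_elim simp
      show "(\<lambda>s. K T s \<bullet> (matrix_inv \<Gamma> *v K T s)) \<in> borel_measurable (time_measure T)"
      proof -
        have "(\<lambda>x. matrix_inv \<Gamma> *v x) \<in> borel_measurable borel"
          by (intro borel_measurable_continuous_onI matrix_vector_mult_linear_continuous_on)
        from measurable_compose[OF k(1) this] show ?thesis by measurable
      qed
    qed simp
    then show ?thesis by simp
  qed
  have D_pos: "D > 0" if "\<kappa> \<noteq> 0"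
    using that \<open>0 \<le> \<kappa>\<close> \<open>0 \<le> G\<close> assms(7,8) unfolding D_def
    by (intro add_pos_nonneg mult_pos_pos) auto
  have D_nonneg: "0 \<le> D"
    using \<open>0 \<le> \<kappa>\<close> \<open>0 \<le> G\<close> assms(7,8) unfolding D_def by simp
  have bs: "bs = N / D"
    using b_star lin[of \<gamma>\<^sub>P 1] lin[of "\<gamma>\<^sub>A + \<gamma>\<^sub>P" 1] by (simp add: N_def D_def)
  \<comment> \<open>For a null kernel the quotient is 0 by the convention on division by zero, and
    \<open>N\<close> is 0 too, so the product form survives.\<close>
  have bsD: "bs * D = N"
    using D_pos null_G by (cases "\<kappa> = 0") (auto simp: bs N_def D_def)
  have chi: "\<chi>\<^sub>0 = \<gamma>\<^sub>P / 2 * (\<gamma>\<^sub>P * \<kappa> - bs * N)"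
  proof -
    have "\<gamma>\<^sub>P *\<^sub>R mat 1 - bs *\<^sub>R (\<gamma>\<^sub>P *\<^sub>R mat 1 + matrix_inv \<Gamma>)
        = (\<gamma>\<^sub>P - bs * \<gamma>\<^sub>P) *\<^sub>R mat 1 + (- bs) *\<^sub>R matrix_inv \<Gamma>"
      by (simp add: algebra_simps)
    then show ?thesis unfolding chi_0 by (simp only: lin) (simp add: N_def algebra_simps)
  qed
  define \<Phi> where "\<Phi> b = \<chi>\<^sub>0 + \<gamma>\<^sub>P / 2 * (D * (b - bs)\<^sup>2)" for b
  have pv: "principal_value M B T g\<^sub>0 K \<Gamma> \<gamma>\<^sub>A \<gamma>\<^sub>P y b = - exp (- \<gamma>\<^sub>P * (g\<^sub>0 T - y) + \<Phi> b)" for y b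
  proof -
    have "\<gamma>\<^sub>P / 2 * (b\<^sup>2 * D - 2 * b * N + \<gamma>\<^sub>P * \<kappa>) = \<Phi> b"
      unfolding quadratic_completed_square[OF bsD] \<Phi>_def chi by (simp add: algebra_simps)
    then show ?thesis
      unfolding principal_value_eq(1)[where K = K and \<Gamma> = \<Gamma>, OF k, folded \<kappa>_def G_def] D_def N_def by simp
  qed
  have \<Phi>_min: "\<chi>\<^sub>0 \<le> \<Phi> b" and \<Phi>_bs: "\<Phi> bs = \<chi>\<^sub>0" for b
    using D_nonneg assms(8) by (auto simp: \<Phi>_def)
  have \<Phi>_eq: "\<Phi> b = \<chi>\<^sub>0 \<longleftrightarrow> \<kappa> = 0 \<or> b = bs" for b
  proof (cases "\<kappa> = 0")
    case True
    then show ?thesis using null_G by (simp add: \<Phi>_def D_def)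
  next
    case False
    then show ?thesis using D_pos assms(8) by (simp add: \<Phi>_def)
  qed
  \<comment> \<open>Lowering the payment and moving to the optimal slope both help the principal.
    Taking \<open>y' = y\<close> gives the optimality in \<open>b\<close>, taking
    \<open>y' = y\<^sub>0\<close> the joint optimality.\<close>
  have pv_le: "principal_value M B T g\<^sub>0 K \<Gamma> \<gamma>\<^sub>A \<gamma>\<^sub>P y b
      \<le> principal_value M B T g\<^sub>0 K \<Gamma> \<gamma>\<^sub>A \<gamma>\<^sub>P y' bs" if "y' \<le> y" for y y' b
    using mult_left_mono[OF that, of \<gamma>\<^sub>P] \<Phi>_min[of b] assms(8)
    by (simp add: pv \<Phi>_bs right_diff_distrib add_mono)
  have V: "V_lin M B T g\<^sub>0 K \<Gamma> \<gamma>\<^sub>A \<gamma>\<^sub>P y = - exp (- \<gamma>\<^sub>P * (g\<^sub>0 T - y) + \<chi>\<^sub>0)" for y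
  proof -
    have "V_lin M B T g\<^sub>0 K \<Gamma> \<gamma>\<^sub>A \<gamma>\<^sub>P y = principal_value M B T g\<^sub>0 K \<Gamma> \<gamma>\<^sub>A \<gamma>\<^sub>P y bs"
      unfolding V_lin_def by (rule cSup_eq_maximum) (auto intro: pv_le)
    then show ?thesis by (simp add: pv \<Phi>_bs)
  qed
  \<comment> \<open>The value decreases in \<open>y\<close>, so the supremum is attained at the
    participation bound.\<close>
  have SUP_V: "(SUP y\<in>{y\<^sub>0..}. V_lin M B T g\<^sub>0 K \<Gamma> \<gamma>\<^sub>A \<gamma>\<^sub>P y) = V_lin M B T g\<^sub>0 K \<Gamma> \<gamma>\<^sub>A \<gamma>\<^sub>P y\<^sub>0"
    by (rule cSup_eq_maximum) (use assms(8) in \<open>auto simp: V\<close>)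
  define I where "I = wiener_integral M B T (K T)"
  have I_null: "AE \<omega> in M. I \<omega> = 0" if "\<kappa> = 0"
    unfolding I_def by (rule wiener_null[OF wiener_wiener_integral[OF k] null[OF that]])
  have reply: "best_reply T K \<Gamma> bs t = matrix_inv \<Gamma> *v \<beta>s t" for t
    by (simp add: best_reply_def beta_star)
  have reply_unique: "AE t in lborel. t \<in> {0..T} \<longrightarrow> best_reply T K \<Gamma> b t = matrix_inv \<Gamma> *v \<beta>s t"
    if "is_arg_max (principal_value M B T g\<^sub>0 K \<Gamma> \<gamma>\<^sub>A \<gamma>\<^sub>P y) (\<lambda>b. True) b" for y b
  proof -
    have "\<Phi> b \<le> \<Phi> bs"
      using that by (auto simp: arg_max_reals_iff pv dest: spec[of _ bs])
    then have "\<kappa> = 0 \<or> b = bs" using \<Phi>_min[of b] \<Phi>_eq[of b] \<Phi>_bs by simp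
    then show ?thesis
    proof
      assume "\<kappa> = 0"
      then have "AE t in lborel. t \<in> {0..T} \<longrightarrow> K T t = 0"
        using null_AE by (subst (asm) AE_restrict_space_iff) auto
      then show ?thesis by eventually_elim (simp add: best_reply_def beta_star)
    qed (simp add: reply)
  qed
  \<comment> \<open>This holds at every \<omega>: output and contract refer to the same selected
    version of the integral of \<open>K T\<close>, so the terms in \<open>g\<^sub>0 T\<close> cancel
    exactly.\<close>
  have contract: "linear_contract M B T K \<Gamma> \<gamma>\<^sub>A y\<^sub>0 bs \<omega> = \<xi>s \<omega>" for \<omega>
    by (simp add: linear_contract_def xi_star beta_star agg_output_def algebra_simps)
  have contract_unique: "AE \<omega> in M. linear_contract M B T K \<Gamma> \<gamma>\<^sub>A y b \<omega> = \<xi>s \<omega>"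
    if "is_arg_max (\<lambda>(y, b). principal_value M B T g\<^sub>0 K \<Gamma> \<gamma>\<^sub>A \<gamma>\<^sub>P y b) (\<lambda>(y, b). y \<ge> y\<^sub>0) (y, b)" for y b
  proof -
    have "y\<^sub>0 \<le> y" and "principal_value M B T g\<^sub>0 K \<Gamma> \<gamma>\<^sub>A \<gamma>\<^sub>P y\<^sub>0 bs \<le> principal_value M B T g\<^sub>0 K \<Gamma> \<gamma>\<^sub>A \<gamma>\<^sub>P y b"
      using that by (auto simp: arg_max_reals_iff)
    then have "\<gamma>\<^sub>P * y + \<Phi> b \<le> \<gamma>\<^sub>P * y\<^sub>0 + \<chi>\<^sub>0" "\<gamma>\<^sub>P * y\<^sub>0 \<le> \<gamma>\<^sub>P * y"
      using assms(8) by (auto simp: pv \<Phi>_bs right_diff_distrib)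
    \<comment> \<open>The excess payment and the slope penalty are both nonnegative, and their sum
      is not positive; hence each is zero.\<close>
    then have "\<gamma>\<^sub>P * y = \<gamma>\<^sub>P * y\<^sub>0" "\<Phi> b = \<chi>\<^sub>0" using \<Phi>_min[of b] by linarith+
    then have y: "y = y\<^sub>0" and "\<kappa> = 0 \<or> b = bs" using \<Phi>_eq assms(8) by auto
    from this(2) show ?thesis
    proof
      assume "\<kappa> = 0"
      \<comment> \<open>For a null kernel the slope is undetermined; the contracts still agree
        because their drift vanishes and their stochastic integral is almost surely 0.\<close>
      have f0: "(LINT s:{0..T}|lborel. f_star \<gamma>\<^sub>A \<Gamma> (c *\<^sub>R K T s)) = 0" for c
      proof -
        have "AE s in lborel. s \<in> {0..T} \<longrightarrow> K T s = 0"
          using null_AE[OF \<open>\<kappa> = 0\<close>] by (subst (asm) AE_restrict_space_iff) auto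
        then have "AE s in lborel. indicat_real {0..T} s *\<^sub>R f_star \<gamma>\<^sub>A \<Gamma> (c *\<^sub>R K T s) = 0"
          by eventually_elim (auto simp: f_star_def indicator_def)
        then show ?thesis
          unfolding set_lebesgue_integral_def by (rule integral_eq_zero_AE)
      qed
      show ?thesis using I_null[OF \<open>\<kappa> = 0\<close>]
      proof eventually_elim
        case (elim \<omega>)
        then show ?case
          unfolding contract[symmetric] by (simp add: linear_contract_def f0 y I_def)
      qed
    next
      assume "b = bs"
      then show ?thesis by (simp add: contract y)
    qed
  qed
  have contract_AE: "AE \<omega> in M. linear_contract M B T K \<Gamma> \<gamma>\<^sub>A y\<^sub>0 bs \<omega> = \<xi>s \<omega>"
    by (simp add: contract)
  show ?thesis
    by (intro conjI allI ballI impI SUP_V V reply contract_AE; (erule reply_unique contract_unique)?)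
       (auto simp: arg_max_reals_iff intro: pv_le)
qed

end
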